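(* Let $m,n,m',n'\ge 0$ and $k\ge l\ge 1$ be integers with $m+k=m'+l$ and $n+k=n'+l$. Then in the module $\mathscr{D}^{m,n}_{m',n'}$ over $\mathbb{Q}(A)$, $$\mathcal{B}^{m,n}_{m',n'}(k,l)=\sum_{i=0}^{\min(m,n,l)}\left\lceil\begin{array}{cc} m&n\\ k&l\end{array}\right\rceil_i\; E^{m,n}_{m',n'}(i,\;k-l+i),$$ where $$\left\lceil\begin{array}{cc} m&n\\ k&l\end{array}\right\rceil_i:=(-A^2)^{i(i-l)}\,\frac{\prod_{j=0}^{l-i-1}\Delta_{k-j-1}\;\prod_{s=0}^{i-1}\Delta_{n-s-1}\Delta_{m-s-1}}{\prod_{t=0}^{l-1}\Delta_{n+k-t-1}\Delta_{m+k-t-1}}\;{l\brack i}_{A^4}\;\prod_{j=0}^{l-i-1}\Delta_{m+n+k-i-j}.$$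
   Context: All skein modules are Kauffman bracket skein modules over the field $\mathbb{Q}(A)$, with relations: crossing $=A\cdot(A\text{-smoothing})+A^{-1}\cdot(B\text{-smoothing})$, and $L\sqcup\text{(trivial circle)}=-(A^2+A^{-2})L$. Put $\Delta_n=(-1)^n\frac{A^{2(n+1)}-A^{-2(n+1)}}{A^2-A^{-2}}$ (so $\Delta_{-1}=0$, $\Delta_0=1$). $f^{(n)}$ is the $n$-th Jones–Wenzl idempotent in the Temperley–Lieb algebra $TL_n$ with loop value $-(A^2+A^{-2})$, drawn as a box with $n$ strands entering and $n$ leaving; $f^{(0)}$ is the empty diagram. Empty products equal $1$. The module $\mathscr{D}^{m,n}_{m',n'}$: consider the disk (rectangle) with $m+n+m'+n'$ marked boundary points grouped into four clusters: $m$ points at the upper left, $n$ at the upper right, $m'$ at the lower left, $n'$ at the lower right. $\mathscr{D}^{m,n}_{m',n'}$ is the submodule of the relative skein module of this disk consisting of all elements obtained by placing $f^{(m)},f^{(n)},f^{(m')},f^{(n')}$ at the respective clusters. Bubble skein element $\mathcal{B}^{m,n}_{m',n'}(k,l)$ (where $m+k=m'+l$, $n+k=n'+l$): in addition to the four boundary idempotents, place two boxes side by side in the interior, $f^{(m+k)}$ on the left and $f^{(n+k)}$ on the right. On the top side of the left box the leftmost $m$ strands run to the upper left cluster and the rightmost $k$ strands are joined by $k$ parallel arcs to the leftmost $k$ strands on the top side of the right box, whose rightmost $n$ top strands run to the upper right cluster. On the bottom side of the left box the leftmost $m'$ strands run to the lower left cluster and the rightmost $l$ strands are joined by $l$ parallel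 arcs to the leftmost $l$ bottom strands of the right box, whose rightmost $n'$ bottom strands run to the lower right cluster. There are no crossings. The element $E^{m,n}_{m',n'}(a,b)$ (where $m-a=m'-b$ and $n-a=n'-b$): the crossingless diagram in $\mathscr{D}^{m,n}_{m',n'}$ with $a$ parallel arcs joining the upper left cluster to the upper right cluster, $b$ parallel arcs joining the lower left cluster to the lower right cluster, $m-a$ strands joining upper left to lower left, and $n-a$ strands joining upper right to lower right (with the four boundary idempotents). Quantum binomial: ${l\brack i}_q=\frac{(q;q)_l}{(q;q)_i(q;q)_{l-i}}$, where $(a;q)_n=\prod_{j=0}^{n-1}(1-aq^j)$. *)

theory Defs
  imports
    "HOL-Library.Poly_Mapping"
    "HOL-Computational_Algebra.Polynomial"
    "HOL-Computational_Algebra.Fraction_Field"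
begin

section \<open>The ground field\<close>

text \<open>The field of rational functions over the rationals in the indeterminate \<open>varA\<close>.\<close>

type_synonym ratfun = "rat poly fract"

definition varA :: ratfun
  where "varA = Fract [:0, 1:] 1"

definition Delta :: "int \<Rightarrow> ratfun"
  where "Delta n = (-1) powi n * (varA powi (2 * (n + 1)) - varA powi (- 2 * (n + 1)))
                    / (varA powi 2 - varA powi (- 2))"

definition qpoch :: "ratfun \<Rightarrow> ratfun \<Rightarrow> nat \<Rightarrow> ratfun"
  where "qpoch a q n = (\<Prod>j<n. 1 - a * q ^ j)"

definition qbinom :: "ratfun \<Rightarrow> nat \<Rightarrow> nat \<Rightarrow> ratfun"
  where "qbinom q l i = qpoch q q l / (qpoch q q i * qpoch q q (l - i))"


section \<open>Tangle diagrams in a rectangle\<close>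

text \<open>
  A tangle diagram in general position with respect to the height function is cut by horizontal
  lines into slices containing a single maximum, minimum or crossing each. A slice \<open>(i, g)\<close> is the
  elementary piece \<open>g\<close> with \<open>i\<close> vertical strands to its left; the number of vertical strands to its
  right is determined by the total number of strands. \<open>Cap\<close> is a maximum (an arc open downwards),
  \<open>Cup\<close> a minimum (an arc open upwards). In \<open>Over\<close> the strand running from the lower left to the
  upper right is the overcrossing strand, in \<open>Under\<close> it is the undercrossing one.
\<close>

datatype piece = Cap | Cup | Over | Under

type_synonym slice = "nat \<times> piece"

fun upper_legs :: "piece \<Rightarrow> nat"
  where
    "upper_legs Cap = 0"
  | "upper_legs Cup = 2"
  | "upper_legs Over = 2"
  | "upper_legs Under = 2"

fun lower_legs :: "piece \<Rightarrow> nat"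
  where
    "lower_legs Cap = 2"
  | "lower_legs Cup = 0"
  | "lower_legs Over = 2"
  | "lower_legs Under = 2"

text \<open>
  Slices are listed from top to bottom. \<open>strands_below p ds\<close> is the number of strands leaving at the
  bottom if \<open>p\<close> strands enter at the top, and \<open>None\<close> if the slices do not fit together.
\<close>

fun strands_below :: "nat \<Rightarrow> slice list \<Rightarrow> nat option"
  where
    "strands_below p [] = Some p"
  | "strands_below p ((i, g) # ds) =
      (if i + upper_legs g \<le> p then strands_below (p - upper_legs g + lower_legs g) ds else None)"

typedef tangle = "{(p, ds). strands_below p ds \<noteq> None}"
  by (rule exI[of _ "(0, [])"]) simp

setup_lifting type_definition_tangle

lift_definition upper :: "tangle \<Rightarrow> nat" is fst .

lift_definition lower :: "tangle \<Rightarrow> nat" is "\<lambda>(p, ds). the (strands_below p ds)" .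

lemma strands_below_append:
  "strands_below p (ds @ es) = Option.bind (strands_below p ds) (\<lambda>q. strands_below q es)"
  by (induction p ds rule: strands_below.induct) auto

lemma strands_below_shift:
  "strands_below (k + p) (map (apfst ((+) k)) ds) = map_option ((+) k) (strands_below p ds)"
  by (induction p ds rule: strands_below.induct) (auto simp: add.assoc)

lemma strands_below_right:
  "strands_below p ds = Some q \<Longrightarrow> strands_below (p + k) ds = Some (q + k)"
proof (induction p ds arbitrary: q rule: strands_below.induct)
  case (2 p i g ds)
  then have le: "i + upper_legs g \<le> p"
    by (auto split: if_splits)
  then have "p + k - upper_legs g + lower_legs g = p - upper_legs g + lower_legs g + k"
    by simp
  with 2 le show ?case
    by simp
qed simp

text \<open>Stacking the first diagram above the second one; only used if the strands match.\<close>

lift_definition stack :: "tangle \<Rightarrow> tangle \<Rightarrow> tangle"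
  is "\<lambda>(p, ds) (q, es). if strands_below p ds = Some q then (p, ds @ es) else (p, ds)"
  by (auto simp: strands_below_append split: if_splits)

text \<open>Placing the first diagram to the left of the second one.\<close>

lift_definition beside :: "tangle \<Rightarrow> tangle \<Rightarrow> tangle"
  is "\<lambda>(p, ds) (q, es). (p + q, ds @ map (apfst ((+) (the (strands_below p ds)))) es)"
proof -
  fix x y :: "nat \<times> slice list"
  assume "x \<in> {(p, ds). strands_below p ds \<noteq> None}" "y \<in> {(p, ds). strands_below p ds \<noteq> None}"
  then obtain p ds q es a b where "x = (p, ds)" "y = (q, es)"
      "strands_below p ds = Some a" "strands_below q es = Some b"
    by auto
  then show "(case x of (p, ds) \<Rightarrow> \<lambda>(q, es).
      (p + q, ds @ map (apfst ((+) (the (strands_below p ds)))) es)) y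
        \<in> {(p, ds). strands_below p ds \<noteq> None}"
    using strands_below_right[of p ds a q] strands_below_shift[of a q es]
    by (simp add: strands_below_append)
qed

text \<open>
  The moves generating isotopy of framed tangles with the blackboard framing: planar isotopy
  (exchange of distant slices, cancellation of a maximum with a minimum, sliding a strand across an
  extremum), the second and third Reidemeister moves and the framed first Reidemeister move (two
  kinks of equal writhe on opposite sides of a strand).
\<close>

fun switch :: "piece \<Rightarrow> piece"
  where
    "switch Over = Under"
  | "switch Under = Over"
  | "switch Cap = Cap"
  | "switch Cup = Cup"

inductive move :: "slice list \<Rightarrow> slice list \<Rightarrow> bool"
  where
    exchange: "move [(i, g), (i + lower_legs g + d, h)] [(i + upper_legs g + d, h), (i, g)]"
  | straighten_left: "move [(i, Cap), (i + 1, Cup)] []"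
  | straighten_right: "move [(i + 1, Cap), (i, Cup)] []"
  | slide_cap: "g \<in> {Over, Under} \<Longrightarrow> move [(i, Cap), (i + 1, g)] [(i + 1, Cap), (i, switch g)]"
  | slide_cup: "g \<in> {Over, Under} \<Longrightarrow> move [(i + 1, g), (i, Cup)] [(i, switch g), (i + 1, Cup)]"
  | kinks: "g \<in> {Over, Under} \<Longrightarrow>
      move [(i + 1, Cap), (i, g), (i + 1, Cup)] [(i, Cap), (i + 1, g), (i, Cup)]"
  | reidemeister2: "g \<in> {Over, Under} \<Longrightarrow> move [(i, g), (i, switch g)] []"
  | reidemeister3: "g \<in> {Over, Under} \<Longrightarrow>
      move [(i, g), (i + 1, g), (i, g)] [(i + 1, g), (i, g), (i + 1, g)]"


section \<open>Kauffman bracket skein modules of the disk\<close>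

definition cmul :: "ratfun \<Rightarrow> ('a \<Rightarrow>\<^sub>0 ratfun) \<Rightarrow> ('a \<Rightarrow>\<^sub>0 ratfun)"
  where "cmul c x = Poly_Mapping.map ((*) c) x"

lemma lookup_cmul [simp]: "Poly_Mapping.lookup (cmul c x) a = c * Poly_Mapping.lookup x a"
  unfolding cmul_def by transfer (simp add: when_def)

interpretation free: vector_space "cmul :: ratfun \<Rightarrow> ('a \<Rightarrow>\<^sub>0 ratfun) \<Rightarrow> _"
  by unfold_locales (auto intro!: poly_mapping_eqI simp: lookup_add algebra_simps)

text \<open>
  \<open>Over\<close> has the vertical strands as its A-smoothing: turning the overcrossing strand
  counterclockwise sweeps out the regions above and below the crossing. For \<open>Under\<close> the two
  smoothings are interchanged.
\<close>

inductive_set skein_relators :: "(tangle \<Rightarrow>\<^sub>0 ratfun) set"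
  where
    isotopy: "Rep_tangle s = (p, ds @ a @ es) \<Longrightarrow> Rep_tangle t = (p, ds @ b @ es) \<Longrightarrow> move a b \<Longrightarrow>
      Poly_Mapping.single s 1 - Poly_Mapping.single t 1 \<in> skein_relators"
  | over: "Rep_tangle s = (p, ds @ [(i, Over)] @ es) \<Longrightarrow> Rep_tangle v = (p, ds @ es) \<Longrightarrow>
      Rep_tangle h = (p, ds @ [(i, Cup), (i, Cap)] @ es) \<Longrightarrow>
      Poly_Mapping.single s 1
        - (Poly_Mapping.single v varA + Poly_Mapping.single h (inverse varA)) \<in> skein_relators"
  | under: "Rep_tangle s = (p, ds @ [(i, Under)] @ es) \<Longrightarrow> Rep_tangle v = (p, ds @ es) \<Longrightarrow>
      Rep_tangle h = (p, ds @ [(i, Cup), (i, Cap)] @ es) \<Longrightarrow>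
      Poly_Mapping.single s 1
        - (Poly_Mapping.single h varA + Poly_Mapping.single v (inverse varA)) \<in> skein_relators"
  | circle: "Rep_tangle s = (p, ds @ [(i, Cap), (i, Cup)] @ es) \<Longrightarrow> Rep_tangle t = (p, ds @ es) \<Longrightarrow>
      Poly_Mapping.single s 1
        - Poly_Mapping.single t (- (varA powi 2 + varA powi (- 2))) \<in> skein_relators"

definition skein_equiv :: "(tangle \<Rightarrow>\<^sub>0 ratfun) \<Rightarrow> (tangle \<Rightarrow>\<^sub>0 ratfun) \<Rightarrow> bool"
  where "skein_equiv x y \<longleftrightarrow> x - y \<in> free.span skein_relators"

text \<open>
  All relators are homogeneous in the numbers of upper and lower boundary points, hence the following
  type is the direct sum, over all \<open>p\<close> and \<open>q\<close>, of the relative skein modules of the rectangle with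
  \<open>p\<close> upper and \<open>q\<close> lower boundary points.
\<close>

quotient_type skein = "tangle \<Rightarrow>\<^sub>0 ratfun" / skein_equiv
proof (rule equivpI)
  show "reflp skein_equiv"
    by (rule reflpI) (simp add: skein_equiv_def free.span_zero)
  show "symp skein_equiv"
    using free.span_neg by (force intro: sympI simp: skein_equiv_def)
  show "transp skein_equiv"
  proof (rule transpI)
    fix x y z
    assume "skein_equiv x y" "skein_equiv y z"
    then have "(x - y) + (y - z) \<in> free.span skein_relators"
      unfolding skein_equiv_def by (rule free.span_add)
    then show "skein_equiv x z"
      by (simp add: skein_equiv_def)
  qed
qed

instantiation skein :: ab_group_add
begin

lift_definition zero_skein :: skein is 0 .

lift_definition plus_skein :: "skein \<Rightarrow> skein \<Rightarrow> skein" is "(+)"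
proof -
  fix x x' y y' :: "tangle \<Rightarrow>\<^sub>0 ratfun"
  assume "skein_equiv x x'" "skein_equiv y y'"
  then have "(x - x') + (y - y') \<in> free.span skein_relators"
    unfolding skein_equiv_def by (rule free.span_add)
  then show "skein_equiv (x + y) (x' + y')"
    by (simp add: skein_equiv_def algebra_simps)
qed

lift_definition uminus_skein :: "skein \<Rightarrow> skein" is uminus
proof -
  fix x x' :: "tangle \<Rightarrow>\<^sub>0 ratfun"
  assume "skein_equiv x x'"
  then have "- (x - x') \<in> free.span skein_relators"
    unfolding skein_equiv_def by (rule free.span_neg)
  then show "skein_equiv (- x) (- x')"
    by (simp add: skein_equiv_def)
qed

lift_definition minus_skein :: "skein \<Rightarrow> skein \<Rightarrow> skein" is "(-)"
proof -
  fix x x' y y' :: "tangle \<Rightarrow>\<^sub>0 ratfun"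
  assume "skein_equiv x x'" "skein_equiv y y'"
  then have "(x - x') - (y - y') \<in> free.span skein_relators"
    unfolding skein_equiv_def by (rule free.span_diff)
  then show "skein_equiv (x - y) (x' - y')"
    by (simp add: skein_equiv_def algebra_simps)
qed

instance
  by standard (transfer, simp add: skein_equiv_def free.span_zero algebra_simps)+

end

lift_definition scale_skein :: "ratfun \<Rightarrow> skein \<Rightarrow> skein" (infixr \<open>*\<^sub>K\<close> 75) is cmul
proof -
  fix c and x x' :: "tangle \<Rightarrow>\<^sub>0 ratfun"
  assume "skein_equiv x x'"
  then have "cmul c (x - x') \<in> free.span skein_relators"
    unfolding skein_equiv_def by (rule free.span_scale)
  then show "skein_equiv (cmul c x) (cmul c x')"
    by (simp add: skein_equiv_def free.scale_right_diff_distrib)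
qed

interpretation skein: vector_space scale_skein
proof
  fix a b :: ratfun and x y :: skein
  show "a *\<^sub>K (x + y) = a *\<^sub>K x + a *\<^sub>K y"
    by transfer (simp add: skein_equiv_def free.span_zero free.scale_right_distrib)
  show "(a + b) *\<^sub>K x = a *\<^sub>K x + b *\<^sub>K x"
    by transfer (simp add: skein_equiv_def free.span_zero free.scale_left_distrib)
  show "a *\<^sub>K b *\<^sub>K x = (a * b) *\<^sub>K x"
    by transfer (simp add: skein_equiv_def free.span_zero)
  show "1 *\<^sub>K x = x"
    by transfer (simp add: skein_equiv_def free.span_zero)
qed

definition skein_of :: "tangle \<Rightarrow> skein"
  where "skein_of t = abs_skein (Poly_Mapping.single t 1)"

text \<open>The relative skein module with \<open>p\<close> upper and \<open>q\<close> lower boundary points.\<close>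

definition skein_module :: "nat \<Rightarrow> nat \<Rightarrow> skein set"
  where "skein_module p q = skein.span (skein_of ` {t. upper t = p \<and> lower t = q})"


subsection \<open>Bilinear extension of stacking and juxtaposition\<close>

definition lin :: "('a \<Rightarrow> ('b \<Rightarrow>\<^sub>0 ratfun)) \<Rightarrow> ('a \<Rightarrow>\<^sub>0 ratfun) \<Rightarrow> ('b \<Rightarrow>\<^sub>0 ratfun)"
  where "lin f x = (\<Sum>s\<in>Poly_Mapping.keys x. cmul (Poly_Mapping.lookup x s) (f s))"

lemma lin_superset:
  assumes "finite S" "Poly_Mapping.keys x \<subseteq> S"
  shows "lin f x = (\<Sum>s\<in>S. cmul (Poly_Mapping.lookup x s) (f s))"
  unfolding lin_def using assms by (intro sum.mono_neutral_left) (auto simp: in_keys_iff)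

lemma lin_add: "lin f (x + y) = lin f x + lin f y"
proof -
  let ?S = "Poly_Mapping.keys x \<union> Poly_Mapping.keys y"
  have "lin f (x + y) = (\<Sum>s\<in>?S. cmul (Poly_Mapping.lookup (x + y) s) (f s))"
    by (rule lin_superset) (auto simp: Poly_Mapping.keys_add)
  then show ?thesis
    by (simp add: lin_superset[of ?S x] lin_superset[of ?S y] lookup_add
        free.scale_left_distrib sum.distrib)
qed

lemma lin_cmul: "lin f (cmul c x) = cmul c (lin f x)"
proof -
  have "lin f (cmul c x) = (\<Sum>s\<in>Poly_Mapping.keys x. cmul (Poly_Mapping.lookup (cmul c x) s) (f s))"
    by (rule lin_superset) (auto simp: in_keys_iff)
  then show ?thesis
    by (simp add: lin_def free.scale_sum_right)
qed

lemma lin_single: "lin f (Poly_Mapping.single s c) = cmul c (f s)"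
  by (cases "c = 0") (simp_all add: lin_def)

lemma cmul_single: "cmul c (Poly_Mapping.single s d) = Poly_Mapping.single s (c * d)"
  by (intro poly_mapping_eqI) (simp add: lookup_single when_def)

lemma lin_diff: "lin f (x - y) = lin f x - lin f y"
proof -
  have "lin f x = lin f (x - y) + lin f y"
    by (simp flip: lin_add)
  then show ?thesis
    by simp
qed

lemma lin_fun_diff: "lin (\<lambda>s. f s - g s) x = lin f x - lin g x"
  by (simp add: lin_def free.scale_right_diff_distrib sum_subtractf)

definition free_above :: "(tangle \<Rightarrow>\<^sub>0 ratfun) \<Rightarrow> (tangle \<Rightarrow>\<^sub>0 ratfun) \<Rightarrow> (tangle \<Rightarrow>\<^sub>0 ratfun)"
  where "free_above x y =
    lin (\<lambda>s. lin (\<lambda>t. if lower s = upper t then Poly_Mapping.single (stack s t) 1 else 0) y) x"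

definition free_beside :: "(tangle \<Rightarrow>\<^sub>0 ratfun) \<Rightarrow> (tangle \<Rightarrow>\<^sub>0 ratfun) \<Rightarrow> (tangle \<Rightarrow>\<^sub>0 ratfun)"
  where "free_beside x y = lin (\<lambda>s. lin (\<lambda>t. Poly_Mapping.single (beside s t) 1) y) x"

lemma lin_in_span:
  assumes "\<And>s. s \<in> Poly_Mapping.keys x \<Longrightarrow> f s \<in> free.span R"
  shows "lin f x \<in> free.span R"
  unfolding lin_def by (intro free.span_sum free.span_scale assms)

lemma lin_span_span:
  assumes "\<And>r. r \<in> R \<Longrightarrow> lin f r \<in> free.span R'" and "x \<in> free.span R"
  shows "lin f x \<in> free.span R'"
  using assms(2)
proof (induction rule: free.span_induct_alt)
  case base
  then show ?case
    by (simp add: lin_def free.span_zero)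
next
  case (step c r y)
  then show ?case
    by (simp add: lin_add lin_cmul free.span_add free.span_scale assms(1))
qed

lemma lin_swap: "lin (\<lambda>s. lin (f s) y) x = lin (\<lambda>t. lin (\<lambda>s. f s t) x) y"
  unfolding lin_def
  by (simp add: free.scale_sum_right mult.commute) (rule sum.swap)

lemma bilinear_respects:
  assumes left: "\<And>r t. r \<in> R \<Longrightarrow> lin (\<lambda>s. f s t) r \<in> free.span R"
    and right: "\<And>r s. r \<in> R \<Longrightarrow> lin (f s) r \<in> free.span R"
    and x: "x - x' \<in> free.span R" and y: "y - y' \<in> free.span R"
  shows "lin (\<lambda>s. lin (f s) y) x - lin (\<lambda>s. lin (f s) y') x' \<in> free.span R"
proof -
  have "lin (\<lambda>s. lin (f s) (y - y')) x \<in> free.span R"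
    by (intro lin_in_span lin_span_span[OF right y])
  moreover have "lin (\<lambda>t. lin (\<lambda>s. f s t) (x - x')) y' \<in> free.span R"
    by (intro lin_in_span lin_span_span[OF left x])
  then have "lin (\<lambda>s. lin (f s) y') (x - x') \<in> free.span R"
    by (subst lin_swap)
  ultimately have "lin (\<lambda>s. lin (f s) (y - y')) x + lin (\<lambda>s. lin (f s) y') (x - x') \<in> free.span R"
    by (rule free.span_add)
  then show ?thesis
    by (simp add: lin_diff lin_fun_diff)
qed

lemma strands_below_Rep: "strands_below (upper s) (snd (Rep_tangle s)) = Some (lower s)"
  by transfer auto

lemma upper_eq: "Rep_tangle s = (p, ds) \<Longrightarrow> upper s = p"
  by (simp add: upper.rep_eq)

lemma Rep_eq_upper: "Rep_tangle s = (upper s, snd (Rep_tangle s))"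
  by (simp add: upper.rep_eq)

lemma lower_eq: "Rep_tangle s = (p, ds) \<Longrightarrow> strands_below p ds = Some (lower s)"
  by (metis strands_below_Rep upper_eq snd_conv)

lemma move_shift: "move a b \<Longrightarrow> move (map (apfst ((+) k)) a) (map (apfst ((+) k)) b)"
proof (induction rule: move.induct)
  case (exchange i g d h)
  show ?case
    using move.exchange[of "k + i" g d h] by (simp add: add.assoc)
next
  case (straighten_left i)
  show ?case
    using move.straighten_left[of "k + i"] by simp
next
  case (straighten_right i)
  show ?case
    using move.straighten_right[of "k + i"] by simp
next
  case (slide_cap g i)
  then show ?case
    using move.slide_cap[of g "k + i"] by simp
next
  case (slide_cup g i)
  then show ?case
    using move.slide_cup[of g "k + i"] by simp
next
  case (kinks g i)
  then show ?case
    using move.kinks[of g "k + i"] by simp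
next
  case (reidemeister2 g i)
  then show ?case
    using move.reidemeister2[of g "k + i"] by simp
next
  case (reidemeister3 g i)
  then show ?case
    using move.reidemeister3[of g "k + i"] by simp
qed

lemma move_strands_below:
  "move a b \<Longrightarrow> strands_below p a = Some q \<Longrightarrow> strands_below p b = Some q' \<Longrightarrow> q = q'"
  by (induction rule: move.induct) (auto split: if_splits)

lemma replace_lower:
  assumes "Rep_tangle s = (p, ds @ a @ es)" "Rep_tangle t = (p, ds @ b @ es)"
    and "\<And>w q q'. strands_below w a = Some q \<Longrightarrow> strands_below w b = Some q' \<Longrightarrow> q = q'"
  shows "lower s = lower t"
proof -
  from lower_eq[OF assms(1)] obtain w x where
    "strands_below p ds = Some w" "strands_below w a = Some x" "strands_below x es = Some (lower s)"
    by (auto simp: strands_below_append bind_eq_Some_conv)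
  moreover from lower_eq[OF assms(2)] this(1) obtain y where
    "strands_below w b = Some y" "strands_below y es = Some (lower t)"
    by (auto simp: strands_below_append bind_eq_Some_conv)
  ultimately show ?thesis
    using assms(3)[of w x y] by simp
qed

lemma relator_context:
  assumes "r \<in> skein_relators"
  obtains p q where
    "\<And>C P us vs k. (\<And>s. upper s = p \<Longrightarrow> lower s = q \<Longrightarrow>
        Rep_tangle (C s) = (P, us @ map (apfst ((+) k)) (snd (Rep_tangle s)) @ vs)) \<Longrightarrow>
      lin (\<lambda>s. Poly_Mapping.single (C s) 1) r \<in> free.span skein_relators"
    "\<And>f g :: tangle \<Rightarrow> (tangle \<Rightarrow>\<^sub>0 ratfun).
      (\<And>s. upper s = p \<Longrightarrow> lower s = q \<Longrightarrow> f s = g s) \<Longrightarrow> lin f r = lin g r"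
  using assms
proof cases
  case (isotopy s p ds a es t b)
  have low: "lower t = lower s"
    using replace_lower[OF isotopy(2,3)] move_strands_below[OF isotopy(4)] by metis
  note up = isotopy(2,3)[THEN upper_eq]
  show ?thesis
  proof (rule that[of p "lower s"])
    fix C P us vs k
    assume C: "\<And>s'. upper s' = p \<Longrightarrow> lower s' = lower s \<Longrightarrow>
      Rep_tangle (C s') = (P, us @ map (apfst ((+) k)) (snd (Rep_tangle s')) @ vs)"
    show "lin (\<lambda>s. Poly_Mapping.single (C s) 1) r \<in> free.span skein_relators"
    proof -
      let ?S = "map (apfst ((+) k))"
      have "Rep_tangle (C s) = (P, (us @ ?S ds) @ ?S a @ (?S es @ vs))"
        "Rep_tangle (C t) = (P, (us @ ?S ds) @ ?S b @ (?S es @ vs))"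
        using C[OF up(1) refl] C[OF up(2) low] by (simp_all add: isotopy(2,3))
      then have "Poly_Mapping.single (C s) 1 - Poly_Mapping.single (C t) 1 \<in> skein_relators"
        by (rule skein_relators.isotopy) (rule move_shift[OF isotopy(4)])
      then show ?thesis
        by (simp add: isotopy(1) lin_diff lin_single free.span_base)
    qed
  next
    fix f g :: "tangle \<Rightarrow> (tangle \<Rightarrow>\<^sub>0 ratfun)"
    assume "\<And>s'. upper s' = p \<Longrightarrow> lower s' = lower s \<Longrightarrow> f s' = g s'"
    then show "lin f r = lin g r"
      by (simp add: isotopy(1) up low lin_diff lin_single)
  qed
next
  case (over s p ds i es v h)
  have low: "lower v = lower s" "lower h = lower s"
    by (rule replace_lower[of v p ds "[]" es s "[(i, Over)]"];
        use over in \<open>auto split: if_splits\<close>)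
      (rule replace_lower[of h p ds "[(i, Cup), (i, Cap)]" es s "[(i, Over)]"];
        use over in \<open>auto split: if_splits\<close>)
  note up = over(2-4)[THEN upper_eq]
  show ?thesis
  proof (rule that[of p "lower s"])
    fix C P us vs k
    assume C: "\<And>s'. upper s' = p \<Longrightarrow> lower s' = lower s \<Longrightarrow>
      Rep_tangle (C s') = (P, us @ map (apfst ((+) k)) (snd (Rep_tangle s')) @ vs)"
    show "lin (\<lambda>s. Poly_Mapping.single (C s) 1) r \<in> free.span skein_relators"
    proof -
      let ?S = "map (apfst ((+) k))"
      have "Rep_tangle (C s) = (P, (us @ ?S ds) @ [(k + i, Over)] @ (?S es @ vs))"
        "Rep_tangle (C v) = (P, (us @ ?S ds) @ (?S es @ vs))"
        "Rep_tangle (C h) = (P, (us @ ?S ds) @ [(k + i, Cup), (k + i, Cap)] @ (?S es @ vs))"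
        using C[OF up(1) refl] C[OF up(2) low(1)] C[OF up(3) low(2)]
        by (simp_all add: over(2-4))
      then have "Poly_Mapping.single (C s) 1 - (Poly_Mapping.single (C v) varA
          + Poly_Mapping.single (C h) (inverse varA)) \<in> skein_relators"
        by (rule skein_relators.over)
      then show ?thesis
        by (simp add: over(1) lin_diff lin_add lin_single cmul_single free.span_base)
    qed
  next
    fix f g :: "tangle \<Rightarrow> (tangle \<Rightarrow>\<^sub>0 ratfun)"
    assume "\<And>s'. upper s' = p \<Longrightarrow> lower s' = lower s \<Longrightarrow> f s' = g s'"
    then show "lin f r = lin g r"
      by (simp add: over(1) up low lin_diff lin_add lin_single)
  qed
next
  case (under s p ds i es v h)
  have low: "lower v = lower s" "lower h = lower s"
    by (rule replace_lower[of v p ds "[]" es s "[(i, Under)]"];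
        use under in \<open>auto split: if_splits\<close>)
      (rule replace_lower[of h p ds "[(i, Cup), (i, Cap)]" es s "[(i, Under)]"];
        use under in \<open>auto split: if_splits\<close>)
  note up = under(2-4)[THEN upper_eq]
  show ?thesis
  proof (rule that[of p "lower s"])
    fix C P us vs k
    assume C: "\<And>s'. upper s' = p \<Longrightarrow> lower s' = lower s \<Longrightarrow>
      Rep_tangle (C s') = (P, us @ map (apfst ((+) k)) (snd (Rep_tangle s')) @ vs)"
    show "lin (\<lambda>s. Poly_Mapping.single (C s) 1) r \<in> free.span skein_relators"
    proof -
      let ?S = "map (apfst ((+) k))"
      have "Rep_tangle (C s) = (P, (us @ ?S ds) @ [(k + i, Under)] @ (?S es @ vs))"
        "Rep_tangle (C v) = (P, (us @ ?S ds) @ (?S es @ vs))"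
        "Rep_tangle (C h) = (P, (us @ ?S ds) @ [(k + i, Cup), (k + i, Cap)] @ (?S es @ vs))"
        using C[OF up(1) refl] C[OF up(2) low(1)] C[OF up(3) low(2)]
        by (simp_all add: under(2-4))
      then have "Poly_Mapping.single (C s) 1 - (Poly_Mapping.single (C h) varA
          + Poly_Mapping.single (C v) (inverse varA)) \<in> skein_relators"
        by (rule skein_relators.under)
      then show ?thesis
        by (simp add: under(1) lin_diff lin_add lin_single cmul_single free.span_base)
    qed
  next
    fix f g :: "tangle \<Rightarrow> (tangle \<Rightarrow>\<^sub>0 ratfun)"
    assume "\<And>s'. upper s' = p \<Longrightarrow> lower s' = lower s \<Longrightarrow> f s' = g s'"
    then show "lin f r = lin g r"
      by (simp add: under(1) up low lin_diff lin_add lin_single)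
  qed
next
  case (circle s p ds i es t)
  have low: "lower t = lower s"
    by (rule replace_lower[of t p ds "[]" es s "[(i, Cap), (i, Cup)]"];
        use circle in \<open>auto split: if_splits\<close>)
  note up = circle(2,3)[THEN upper_eq]
  show ?thesis
  proof (rule that[of p "lower s"])
    fix C P us vs k
    assume C: "\<And>s'. upper s' = p \<Longrightarrow> lower s' = lower s \<Longrightarrow>
      Rep_tangle (C s') = (P, us @ map (apfst ((+) k)) (snd (Rep_tangle s')) @ vs)"
    show "lin (\<lambda>s. Poly_Mapping.single (C s) 1) r \<in> free.span skein_relators"
    proof -
      let ?S = "map (apfst ((+) k))"
      have "Rep_tangle (C s) = (P, (us @ ?S ds) @ [(k + i, Cap), (k + i, Cup)] @ (?S es @ vs))"
        "Rep_tangle (C t) = (P, (us @ ?S ds) @ (?S es @ vs))"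
        using C[OF up(1) refl] C[OF up(2) low] by (simp_all add: circle(2,3))
      then have "Poly_Mapping.single (C s) 1
          - Poly_Mapping.single (C t) (- (varA powi 2 + varA powi (- 2))) \<in> skein_relators"
        by (rule skein_relators.circle)
      then show ?thesis
        by (simp add: circle(1) lin_diff lin_single cmul_single free.span_base)
    qed
  next
    fix f g :: "tangle \<Rightarrow> (tangle \<Rightarrow>\<^sub>0 ratfun)"
    assume "\<And>s'. upper s' = p \<Longrightarrow> lower s' = lower s \<Longrightarrow> f s' = g s'"
    then show "lin f r = lin g r"
      by (simp add: circle(1) up low lin_diff lin_single)
  qed
qed

lemma Rep_stack:
  "lower s = upper t \<Longrightarrow>
    Rep_tangle (stack s t) = (upper s, snd (Rep_tangle s) @ snd (Rep_tangle t))"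
  by transfer auto

lemma Rep_beside:
  "Rep_tangle (beside s t) =
    (upper s + upper t, snd (Rep_tangle s) @ map (apfst ((+) (lower s))) (snd (Rep_tangle t)))"
  by transfer auto

lemma apfst_plus_0 [simp]: "apfst ((+) (0 :: nat)) = id"
  by (auto simp: fun_eq_iff)

lemma above_left:
  assumes "r \<in> skein_relators"
  shows "lin (\<lambda>s. if lower s = upper t then Poly_Mapping.single (stack s t) 1 else 0) r
    \<in> free.span skein_relators"
proof -
  from assms obtain p q where
    ctx: "\<And>C P us vs k. (\<And>s. upper s = p \<Longrightarrow> lower s = q \<Longrightarrow>
        Rep_tangle (C s) = (P, us @ map (apfst ((+) k)) (snd (Rep_tangle s)) @ vs)) \<Longrightarrow>
      lin (\<lambda>s. Poly_Mapping.single (C s) 1) r \<in> free.span skein_relators"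
    and cong: "\<And>f g :: tangle \<Rightarrow> (tangle \<Rightarrow>\<^sub>0 ratfun).
      (\<And>s. upper s = p \<Longrightarrow> lower s = q \<Longrightarrow> f s = g s) \<Longrightarrow> lin f r = lin g r"
    by (rule relator_context) blast
  show ?thesis
  proof (cases "q = upper t")
    case True
    then have "lin (\<lambda>s. if lower s = upper t then Poly_Mapping.single (stack s t) 1 else 0) r
        = lin (\<lambda>s. Poly_Mapping.single (stack s t) 1) r"
      by (intro cong) simp
    then show ?thesis
      using ctx[of "\<lambda>s. stack s t" p "[]" 0 "snd (Rep_tangle t)"] True by (simp add: Rep_stack)
  next
    case False
    then have "lin (\<lambda>s. if lower s = upper t then Poly_Mapping.single (stack s t) 1 else 0) r
        = lin (\<lambda>s. 0 :: tangle \<Rightarrow>\<^sub>0 ratfun) r"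
      by (intro cong) simp
    then show ?thesis
      by (simp add: lin_def free.span_zero)
  qed
qed

lemma above_right:
  assumes "r \<in> skein_relators"
  shows "lin (\<lambda>t. if lower s = upper t then Poly_Mapping.single (stack s t) 1 else 0) r
    \<in> free.span skein_relators"
proof -
  from assms obtain p q where
    ctx: "\<And>C P us vs k. (\<And>s. upper s = p \<Longrightarrow> lower s = q \<Longrightarrow>
        Rep_tangle (C s) = (P, us @ map (apfst ((+) k)) (snd (Rep_tangle s)) @ vs)) \<Longrightarrow>
      lin (\<lambda>s. Poly_Mapping.single (C s) 1) r \<in> free.span skein_relators"
    and cong: "\<And>f g :: tangle \<Rightarrow> (tangle \<Rightarrow>\<^sub>0 ratfun).
      (\<And>s. upper s = p \<Longrightarrow> lower s = q \<Longrightarrow> f s = g s) \<Longrightarrow> lin f r = lin g r"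
    by (rule relator_context) blast
  show ?thesis
  proof (cases "lower s = p")
    case True
    then have "lin (\<lambda>t. if lower s = upper t then Poly_Mapping.single (stack s t) 1 else 0) r
        = lin (\<lambda>t. Poly_Mapping.single (stack s t) 1) r"
      by (intro cong) simp
    then show ?thesis
      using ctx[of "stack s" "upper s" "snd (Rep_tangle s)" 0 "[]"] True by (simp add: Rep_stack)
  next
    case False
    then have "lin (\<lambda>t. if lower s = upper t then Poly_Mapping.single (stack s t) 1 else 0) r
        = lin (\<lambda>t. 0 :: tangle \<Rightarrow>\<^sub>0 ratfun) r"
      by (intro cong) simp
    then show ?thesis
      by (simp add: lin_def free.span_zero)
  qed
qed

lemma beside_left:
  assumes "r \<in> skein_relators"
  shows "lin (\<lambda>s. Poly_Mapping.single (beside s t) 1) r \<in> free.span skein_relators"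
proof -
  from assms obtain p q where
    ctx: "\<And>C P us vs k. (\<And>s. upper s = p \<Longrightarrow> lower s = q \<Longrightarrow>
        Rep_tangle (C s) = (P, us @ map (apfst ((+) k)) (snd (Rep_tangle s)) @ vs)) \<Longrightarrow>
      lin (\<lambda>s. Poly_Mapping.single (C s) 1) r \<in> free.span skein_relators"
    by (rule relator_context) blast
  show ?thesis
    using ctx[of "\<lambda>s. beside s t" "p + upper t" "[]" 0 "map (apfst ((+) q)) (snd (Rep_tangle t))"]
    by (simp add: Rep_beside)
qed

lemma beside_right:
  assumes "r \<in> skein_relators"
  shows "lin (\<lambda>t. Poly_Mapping.single (beside s t) 1) r \<in> free.span skein_relators"
proof -
  from assms obtain p q where
    ctx: "\<And>C P us vs k. (\<And>s. upper s = p \<Longrightarrow> lower s = q \<Longrightarrow>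
        Rep_tangle (C s) = (P, us @ map (apfst ((+) k)) (snd (Rep_tangle s)) @ vs)) \<Longrightarrow>
      lin (\<lambda>s. Poly_Mapping.single (C s) 1) r \<in> free.span skein_relators"
    by (rule relator_context) blast
  show ?thesis
    using ctx[of "beside s" "upper s + p" "snd (Rep_tangle s)" "lower s" "[]"]
    by (simp add: Rep_beside)
qed

text \<open>
  \<open>above x y\<close> places \<open>x\<close> above \<open>y\<close>, joining lower points of \<open>x\<close> to upper points of \<open>y\<close>; it is zero
  on components whose numbers of points differ. \<open>next_to x y\<close> places \<open>x\<close> to the left of \<open>y\<close>.
\<close>

lift_definition above :: "skein \<Rightarrow> skein \<Rightarrow> skein" (infixr \<open>\<fatsemi>\<close> 70) is free_above
  unfolding skein_equiv_def free_above_def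
  by (rule bilinear_respects[OF above_left above_right])

lift_definition next_to :: "skein \<Rightarrow> skein \<Rightarrow> skein" (infixr \<open>\<parallel>\<close> 72) is free_beside
  unfolding skein_equiv_def free_beside_def
  by (rule bilinear_respects[OF beside_left beside_right])


subsection \<open>Elementary diagrams\<close>

lift_definition strands_tangle :: "nat \<Rightarrow> tangle" is "\<lambda>n. (n, [])"
  by simp

lift_definition cap_tangle :: tangle is "(0, [(0, Cap)])"
  by simp

lift_definition cup_tangle :: tangle is "(2, [(0, Cup)])"
  by simp

definition strands :: "nat \<Rightarrow> skein"
  where "strands n = skein_of (strands_tangle n)"

text \<open>\<open>k\<close> parallel (hence nested) arcs with all endpoints on the lower, respectively upper side\<close>

primrec caps :: "nat \<Rightarrow> skein"
  where
    "caps 0 = strands 0"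
  | "caps (Suc k) = skein_of cap_tangle \<fatsemi> (strands 1 \<parallel> caps k \<parallel> strands 1)"

primrec cups :: "nat \<Rightarrow> skein"
  where
    "cups 0 = strands 0"
  | "cups (Suc k) = (strands 1 \<parallel> cups k \<parallel> strands 1) \<fatsemi> skein_of cup_tangle"


section \<open>Jones--Wenzl idempotents and the bubble skein element\<close>

text \<open>The Temperley--Lieb algebra on \<open>n\<close> strands is \<open>skein_module n n\<close>; this is Wenzl's recursion.\<close>

fun jones_wenzl :: "nat \<Rightarrow> skein"
  where
    "jones_wenzl 0 = strands 0"
  | "jones_wenzl (Suc 0) = strands 1"
  | "jones_wenzl (Suc (Suc n)) =
      jones_wenzl (Suc n) \<parallel> strands 1
      - (Delta (int n) / Delta (int n + 1)) *\<^sub>K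
          ((jones_wenzl (Suc n) \<parallel> strands 1)
            \<fatsemi> (strands n \<parallel> (cups 1 \<fatsemi> caps 1))
            \<fatsemi> (jones_wenzl (Suc n) \<parallel> strands 1))"

text \<open>
  The arguments \<open>m n m' n'\<close> are the sizes of the upper left, upper right, lower left and lower right
  cluster.
\<close>

definition place_idempotents :: "nat \<Rightarrow> nat \<Rightarrow> nat \<Rightarrow> nat \<Rightarrow> skein \<Rightarrow> skein"
  where "place_idempotents m n m' n' x =
    (jones_wenzl m \<parallel> jones_wenzl n) \<fatsemi> x \<fatsemi> (jones_wenzl m' \<parallel> jones_wenzl n')"

definition clustered_module :: "nat \<Rightarrow> nat \<Rightarrow> nat \<Rightarrow> nat \<Rightarrow> skein set"
  where "clustered_module m n m' n' =
    place_idempotents m n m' n' ` skein_module (m + n) (m' + n')"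

text \<open>Meaningful for \<open>m + k = m' + l\<close> and \<open>n + k = n' + l\<close>.\<close>

definition bubble :: "nat \<Rightarrow> nat \<Rightarrow> nat \<Rightarrow> nat \<Rightarrow> nat \<Rightarrow> nat \<Rightarrow> skein"
  where "bubble m n m' n' k l = place_idempotents m n m' n'
    ((strands m \<parallel> caps k \<parallel> strands n)
      \<fatsemi> (jones_wenzl (m + k) \<parallel> jones_wenzl (n + k))
      \<fatsemi> (strands m' \<parallel> cups l \<parallel> strands n'))"

text \<open>Meaningful for \<open>a \<le> m\<close>, \<open>a \<le> n\<close>, \<open>m - a = m' - b\<close> and \<open>n - a = n' - b\<close> over the integers.\<close>

definition arcs_element :: "nat \<Rightarrow> nat \<Rightarrow> nat \<Rightarrow> nat \<Rightarrow> nat \<Rightarrow> nat \<Rightarrow> skein"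
  where "arcs_element m n m' n' a b = place_idempotents m n m' n'
    ((strands (m - a) \<parallel> cups a \<parallel> strands (n - a))
      \<fatsemi> (strands (m' - b) \<parallel> caps b \<parallel> strands (n' - b)))"

definition bubble_coeff :: "nat \<Rightarrow> nat \<Rightarrow> nat \<Rightarrow> nat \<Rightarrow> nat \<Rightarrow> ratfun"
  where "bubble_coeff m n k l i =
    (- (varA ^ 2)) powi (int i * (int i - int l))
    * (((\<Prod>j<l - i. Delta (int k - int j - 1))
         * (\<Prod>s<i. Delta (int n - int s - 1) * Delta (int m - int s - 1)))
       / (\<Prod>t<l. Delta (int n + int k - int t - 1) * Delta (int m + int k - int t - 1)))
    * qbinom (varA ^ 4) l i
    * (\<Prod>j<l - i. Delta (int m + int n + int k - int i - int j))"

end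

theory Submission
  imports Defs
begin

text \<open>
  Induction on \<open>l\<close> reduces everything to the innermost lower arc: peeling it off gives
  \<open>B(m, n, k, l) = \<gamma> B(m, n, k - 1, l - 1) + \<epsilon> B(m - 1, n - 1, k, l - 1)\<close>, where in the second term
  one arc is split off at the top. With \<open>[x] = Delta (x - 1)\<close>, which is the quantum integer at
  \<open>q = - A\<^sup>2\<close>, and \<open>D = [m + k] [n + k]\<close>, one has \<open>\<gamma> = [k] [m + n + k + 1] / D\<close> and
  \<open>\<epsilon> = [m] [n] / D\<close>. This relation is proved by induction on \<open>k\<close>: expanding the two boxes by Wenzl's
  recursion, each along the strand next to the other box, closes the lower arc into a partial trace
  or a zigzag. The coefficients satisfy the same recursion because of
  \<open>[l] [M - i] = [l - i] [M] + [i] [M - l]\<close>.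
\<close>

section \<open>The skein category\<close>

text \<open>The peeling relation concerns only the upper half of the bubble; the remaining lower
  arcs are a common factor. Expanding both boxes yields a multiple of the half with one arc fewer,
  plus a term with a minimum and a maximum between boxes. There the minimum closes the smaller half,
  so the induction hypothesis applies. The denominators cancel telescopically,
  \<open>[m] [n]\<close> survives in \<open>\<epsilon>\<close>, and the numerator of
  \<open>\<gamma>\<close> accumulates as the sum of \<open>[m + n + 2 j]\<close> for
  \<open>1 \<le> j \<le> k\<close>, which is \<open>[k] [m + n + k + 1]\<close>. The obstacle:
  Wenzl's recursion adds strands on the right, whereas the right box has to be opened along its
  leftmost strand. The mirrored recursion is obtained without reflecting diagrams: an idempotent
  annihilated by all Temperley-Lieb generators is unique, and the recursion can run through the
  generators in reverse order. Hence the idempotents are studied for an abstract family of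
  generators. Truncated differences such as m - 1 at m = 0 give meaningless diagrams, but always
  under a coefficient containing \<open>[0]\<close>.\<close>

lemma skein_of_induct [case_names zero add scale basis]:
  assumes "P 0" "\<And>x y. P x \<Longrightarrow> P y \<Longrightarrow> P (x + y)" "\<And>c x. P x \<Longrightarrow> P (c *\<^sub>K x)"
    and "\<And>t. P (skein_of t)"
  shows "P x"
proof -
  \<comment> \<open>Elements of the quotient are classes of finite formal sums of diagrams, so it
    suffices to treat such sums.\<close>
  have *: "P (abs_skein (\<Sum>t\<in>T. Poly_Mapping.single t (c t)))" for T c
  proof (induction T rule: infinite_finite_induct)
    case (insert t T)
    have "abs_skein (Poly_Mapping.single t (c t)) = c t *\<^sub>K skein_of t"
      by (simp add: skein_of_def scale_skein.abs_eq cmul_single)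
    with insert show ?case
      using assms(2-4) by (simp flip: plus_skein.abs_eq)
  qed (use assms(1) in \<open>simp_all add: zero_skein_def\<close>)
  have "y = (\<Sum>t\<in>Poly_Mapping.keys y. Poly_Mapping.single t (Poly_Mapping.lookup y t))" for y
    by (rule poly_mapping_eqI) (simp add: lookup_sum lookup_single when_def in_keys_iff)
  then have "P (abs_skein y)" for y
    using * by metis
  then show ?thesis
    using Quotient3_abs_rep[OF Quotient3_skein] by metis
qed

section \<open>Bilinearity, associativity and units\<close>

lemma above_add_left: "(x + y) \<fatsemi> z = x \<fatsemi> z + y \<fatsemi> z"
  by transfer (simp add: free_above_def lin_add skein_equiv_def free.span_zero)

text \<open>Exchanging the two sums makes the second factor the outer one, so that linearity in it
  is linearity of \<open>lin\<close>.\<close>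

lemma free_above_swap: "free_above x y =
    lin (\<lambda>t. lin (\<lambda>s. if lower s = upper t then Poly_Mapping.single (stack s t) 1 else 0) x) y"
  unfolding free_above_def by (rule lin_swap)

lemma free_beside_swap: "free_beside x y =
    lin (\<lambda>t. lin (\<lambda>s. Poly_Mapping.single (beside s t) 1) x) y"
  unfolding free_beside_def by (rule lin_swap)

lemma above_add_right: "z \<fatsemi> (x + y) = z \<fatsemi> x + z \<fatsemi> y"
  by transfer (simp add: free_above_swap lin_add skein_equiv_def free.span_zero)

lemma above_scale_left: "(c *\<^sub>K x) \<fatsemi> z = c *\<^sub>K (x \<fatsemi> z)"
  by transfer (simp add: free_above_def lin_cmul skein_equiv_def free.span_zero)

lemma above_scale_right: "z \<fatsemi> (c *\<^sub>K x) = c *\<^sub>K (z \<fatsemi> x)"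
  by transfer (simp add: free_above_swap lin_cmul skein_equiv_def free.span_zero)

lemma next_to_add_left: "(x + y) \<parallel> z = x \<parallel> z + y \<parallel> z"
  by transfer (simp add: free_beside_def lin_add skein_equiv_def free.span_zero)

lemma next_to_add_right: "z \<parallel> (x + y) = z \<parallel> x + z \<parallel> y"
  by transfer (simp add: free_beside_swap lin_add skein_equiv_def free.span_zero)

lemma next_to_scale_left: "(c *\<^sub>K x) \<parallel> z = c *\<^sub>K (x \<parallel> z)"
  by transfer (simp add: free_beside_def lin_cmul skein_equiv_def free.span_zero)

lemma next_to_scale_right: "z \<parallel> (c *\<^sub>K x) = c *\<^sub>K (z \<parallel> x)"
  by transfer (simp add: free_beside_swap lin_cmul skein_equiv_def free.span_zero)

lemma above_zero_left [simp]: "0 \<fatsemi> z = 0"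
  using above_scale_left[of 0 0 z] by simp

lemma above_zero_right [simp]: "z \<fatsemi> 0 = 0"
  using above_scale_right[of z 0 0] by simp

lemma next_to_zero_left [simp]: "0 \<parallel> z = 0"
  using next_to_scale_left[of 0 0 z] by simp

lemma next_to_zero_right [simp]: "z \<parallel> 0 = 0"
  using next_to_scale_right[of z 0 0] by simp

lemma above_diff_left: "(x - y) \<fatsemi> z = x \<fatsemi> z - y \<fatsemi> z"
  using above_add_left[of "x - y" y z] by simp

lemma above_diff_right: "z \<fatsemi> (x - y) = z \<fatsemi> x - z \<fatsemi> y"
  using above_add_right[of z "x - y" y] by simp

lemma next_to_diff_left: "(x - y) \<parallel> z = x \<parallel> z - y \<parallel> z"
  using next_to_add_left[of "x - y" y z] by simp

lemma next_to_diff_right: "z \<parallel> (x - y) = z \<parallel> x - z \<parallel> y"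
  using next_to_add_right[of z "x - y" y] by simp

lemma above_sum_right: "z \<fatsemi> sum f I = (\<Sum>i\<in>I. z \<fatsemi> f i)"
  by (induction I rule: infinite_finite_induct) (simp_all add: above_add_right)

lemmas skein_linear =
  above_add_left above_add_right above_diff_left above_diff_right above_scale_left above_scale_right
  next_to_add_left next_to_add_right next_to_diff_left next_to_diff_right
  next_to_scale_left next_to_scale_right

lemma skein_of_above:
  "skein_of s \<fatsemi> skein_of t = (if lower s = upper t then skein_of (stack s t) else 0)"
  by (auto simp: skein_of_def above.abs_eq free_above_def lin_single zero_skein_def)

lemma skein_of_next_to: "skein_of s \<parallel> skein_of t = skein_of (beside s t)"
  by (simp add: skein_of_def next_to.abs_eq free_beside_def lin_single)

lemma tangle_eqI: "upper s = upper t \<Longrightarrow> snd (Rep_tangle s) = snd (Rep_tangle t) \<Longrightarrow> s = t"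
  by (metis Rep_eq_upper Rep_tangle_inject)

lemma upper_stack: "lower s = upper t \<Longrightarrow> upper (stack s t) = upper s"
  by (rule upper_eq[OF Rep_stack])

lemma lower_stack: "lower s = upper t \<Longrightarrow> lower (stack s t) = lower t"
  using lower_eq[OF Rep_stack, of s t] strands_below_Rep[of s] strands_below_Rep[of t]
  by (simp add: strands_below_append)

lemma upper_beside: "upper (beside s t) = upper s + upper t"
  by (rule upper_eq[OF Rep_beside])

lemma lower_beside: "lower (beside s t) = lower s + lower t"
  using lower_eq[OF Rep_beside, of s t] strands_below_Rep[of t]
    strands_below_right[OF strands_below_Rep, of s "upper t"]
    strands_below_shift[of "lower s" "upper t" "snd (Rep_tangle t)"]
  by (simp add: strands_below_append)

text \<open>Composition concatenates slice lists, which is strictly associative. The value 0 for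
  mismatched strand numbers is consistent with this, since both sides vanish unless both joints
  fit.\<close>

lemma above_assoc: "(x \<fatsemi> y) \<fatsemi> z = x \<fatsemi> y \<fatsemi> z"
proof (induction x rule: skein_of_induct)
  case (basis s)
  show ?case
  proof (induction y rule: skein_of_induct)
    case (basis t)
    show ?case
    proof (induction z rule: skein_of_induct)
      case (basis u)
      have "stack (stack s t) u = stack s (stack t u)" if "lower s = upper t" "lower t = upper u"
        using that by (intro tangle_eqI) (simp_all add: upper_stack lower_stack Rep_stack)
      then show ?case
        by (simp add: skein_of_above upper_stack lower_stack)
    qed (simp_all add: skein_linear)
  qed (simp_all add: skein_linear)
qed (simp_all add: skein_linear)

lemma next_to_assoc: "(x \<parallel> y) \<parallel> z = x \<parallel> y \<parallel> z"
proof (induction x rule: skein_of_induct)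
  case (basis s)
  show ?case
  proof (induction y rule: skein_of_induct)
    case (basis t)
    show ?case
    proof (induction z rule: skein_of_induct)
      case (basis u)
      have "beside (beside s t) u = beside s (beside t u)"
        by (intro tangle_eqI)
          (auto simp: upper_beside lower_beside Rep_beside add.assoc apfst_def map_prod_def)
      then show ?case
        by (simp add: skein_of_next_to)
    qed (simp_all add: skein_linear)
  qed (simp_all add: skein_linear)
qed (simp_all add: skein_linear)

lemma Rep_strands_tangle [simp]: "Rep_tangle (strands_tangle n) = (n, [])"
  by (rule strands_tangle.rep_eq)

lemma upper_strands [simp]: "upper (strands_tangle n) = n"
  by (simp add: upper.rep_eq)

lemma lower_strands [simp]: "lower (strands_tangle n) = n"
  by (simp add: lower.rep_eq)

lemma strands_next_to_strands: "strands m \<parallel> strands n = strands (m + n)"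
proof -
  have "beside (strands_tangle m) (strands_tangle n) = strands_tangle (m + n)"
    by (rule tangle_eqI) (simp_all add: upper_beside Rep_beside)
  then show ?thesis
    by (simp add: strands_def skein_of_next_to)
qed

lemma strands_next_to_strands_left: "strands m \<parallel> strands n \<parallel> x = strands (m + n) \<parallel> x"
  by (simp add: strands_next_to_strands flip: next_to_assoc)

lemma next_to_strands_0 [simp]: "x \<parallel> strands 0 = x"
proof (induction x rule: skein_of_induct)
  case (basis t)
  have "beside t (strands_tangle 0) = t"
    by (rule tangle_eqI) (simp_all add: upper_beside Rep_beside)
  then show ?case
    by (simp add: strands_def skein_of_next_to)
qed (simp_all add: skein_linear)

lemma strands_0_next_to [simp]: "strands 0 \<parallel> x = x"
proof (induction x rule: skein_of_induct)
  case (basis t)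
  have "beside (strands_tangle 0) t = t"
    by (rule tangle_eqI) (simp_all add: upper_beside Rep_beside)
  then show ?case
    by (simp add: strands_def skein_of_next_to)
qed (simp_all add: skein_linear)

text \<open>In contrast to \<open>skein_of_induct\<close>, the numbers of boundary points are
  retained; \<open>strands p\<close> is neutral only for diagrams with p points on the side where it
  is attached.\<close>

lemma skein_module_induct [consumes 1, case_names zero add scale basis]:
  assumes "x \<in> skein_module p q"
    and "P 0" "\<And>x y. P x \<Longrightarrow> P y \<Longrightarrow> P (x + y)" "\<And>c x. P x \<Longrightarrow> P (c *\<^sub>K x)"
    and "\<And>t. upper t = p \<Longrightarrow> lower t = q \<Longrightarrow> P (skein_of t)"
  shows "P x"
  using assms(1) unfolding skein_module_def
proof (induction rule: skein.span_induct_alt)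
  case base
  then show ?case
    by (rule assms)
next
  case (step c x y)
  then show ?case
    using assms(3-5) by auto
qed

lemma skein_module_basis: "skein_of t \<in> skein_module (upper t) (lower t)"
  unfolding skein_module_def by (rule skein.span_base) auto

lemma skein_module_zero: "0 \<in> skein_module p q"
  unfolding skein_module_def by (rule skein.span_zero)

lemma skein_module_add:
  "x \<in> skein_module p q \<Longrightarrow> y \<in> skein_module p q \<Longrightarrow> x + y \<in> skein_module p q"
  unfolding skein_module_def by (rule skein.span_add)

lemma skein_module_diff:
  "x \<in> skein_module p q \<Longrightarrow> y \<in> skein_module p q \<Longrightarrow> x - y \<in> skein_module p q"
  unfolding skein_module_def by (rule skein.span_diff)

lemma skein_module_scale: "x \<in> skein_module p q \<Longrightarrow> c *\<^sub>K x \<in> skein_module p q"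
  unfolding skein_module_def by (rule skein.span_scale)

lemma strands_above: "x \<in> skein_module p q \<Longrightarrow> strands p \<fatsemi> x = x"
proof (induction rule: skein_module_induct)
  case (basis t)
  then have "stack (strands_tangle p) t = t"
    by (intro tangle_eqI) (simp_all add: upper_stack Rep_stack)
  with basis show ?case
    by (simp add: strands_def skein_of_above)
qed (simp_all add: skein_linear)

lemma above_strands: "x \<in> skein_module p q \<Longrightarrow> x \<fatsemi> strands q = x"
proof (induction rule: skein_module_induct)
  case (basis t)
  then have "stack t (strands_tangle q) = t"
    by (intro tangle_eqI) (simp_all add: upper_stack Rep_stack)
  with basis show ?case
    by (simp add: strands_def skein_of_above)
qed (simp_all add: skein_linear)

lemma skein_module_above:
  assumes "x \<in> skein_module p q" "y \<in> skein_module q r"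
  shows "x \<fatsemi> y \<in> skein_module p r"
  using assms(1)
proof (induction rule: skein_module_induct)
  case (basis s)
  from assms(2) show ?case
  proof (induction rule: skein_module_induct)
    case (basis t)
    then show ?case
      using \<open>upper s = p\<close> \<open>lower s = q\<close> skein_module_basis[of "stack s t"]
      by (simp add: skein_of_above upper_stack lower_stack)
  qed (simp_all add: skein_linear skein_module_zero skein_module_add skein_module_scale)
qed (simp_all add: skein_linear skein_module_zero skein_module_add skein_module_scale)

lemma skein_module_next_to:
  assumes "x \<in> skein_module p q" "y \<in> skein_module r s"
  shows "x \<parallel> y \<in> skein_module (p + r) (q + s)"
  using assms(1)
proof (induction rule: skein_module_induct)
  case (basis t)
  from assms(2) show ?case
  proof (induction rule: skein_module_induct)
    case (basis u)
    then show ?case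
      using \<open>upper t = p\<close> \<open>lower t = q\<close> skein_module_basis[of "beside t u"]
      by (simp add: skein_of_next_to upper_beside lower_beside)
  qed (simp_all add: skein_linear skein_module_zero skein_module_add skein_module_scale)
qed (simp_all add: skein_linear skein_module_zero skein_module_add skein_module_scale)

lemma strands_in_skein_module: "strands n \<in> skein_module n n"
  using skein_module_basis[of "strands_tangle n"] by (simp add: strands_def)

text \<open>Each layer of a diagram is written as one active piece between vertical strands.
  Stacking is then the only operation left, and calculations become rewriting of words in padded
  pieces.\<close>

definition pad :: "nat \<Rightarrow> skein \<Rightarrow> nat \<Rightarrow> skein"
  where "pad i x j = strands i \<parallel> x \<parallel> strands j"

lemma pad_linear:
  "pad i (x + y) j = pad i x j + pad i y j" "pad i (x - y) j = pad i x j - pad i y j"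
  "pad i (c *\<^sub>K x) j = c *\<^sub>K pad i x j" "pad i 0 j = 0"
  by (simp_all add: pad_def skein_linear)

lemma pad_above: "pad i (x \<fatsemi> y) j = pad i x j \<fatsemi> pad i y j"
proof (induction x rule: skein_of_induct)
  case (basis s)
  show ?case
  proof (induction y rule: skein_of_induct)
    case (basis t)
    let ?P = "\<lambda>t. beside (strands_tangle i) (beside t (strands_tangle j))"
    have "stack (?P s) (?P t) = ?P (stack s t)" if "lower s = upper t"
      using that by (intro tangle_eqI)
        (simp_all add: upper_stack upper_beside lower_beside Rep_beside Rep_stack)
    then show ?case
      by (simp add: pad_def strands_def skein_of_next_to skein_of_above upper_beside lower_beside)
  qed (simp_all add: skein_linear pad_linear)
qed (simp_all add: skein_linear pad_linear)

lemma pad_pad: "pad i (pad i' x j') j = pad (i + i') x (j' + j)"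
  by (simp add: pad_def next_to_assoc strands_next_to_strands strands_next_to_strands_left)

lemma pad_strands: "pad i (strands n) j = strands (i + n + j)"
  by (simp add: pad_def strands_next_to_strands strands_next_to_strands_left add.assoc)

lemma pad_0_0 [simp]: "pad 0 x 0 = x"
  by (simp add: pad_def)

lemma skein_module_pad:
  "x \<in> skein_module p q \<Longrightarrow> i + p + j = p' \<Longrightarrow> i + q + j = q' \<Longrightarrow> pad i x j \<in> skein_module p' q'"
  unfolding pad_def
  by (auto simp: add.assoc intro!: skein_module_next_to strands_in_skein_module)

section \<open>Slice lists and planar isotopy\<close>

definition word :: "nat \<Rightarrow> slice list \<Rightarrow> skein"
  where "word p ds = (if strands_below p ds = None then 0 else skein_of (Abs_tangle (p, ds)))"

lemma skein_of_eq_word: "skein_of t = word (upper t) (snd (Rep_tangle t))"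
  by (simp add: word_def strands_below_Rep Rep_tangle_inverse flip: Rep_eq_upper)

lemma word_move:
  assumes "move a b" "strands_below p (ds @ a @ es) \<noteq> None" "strands_below p (ds @ b @ es) \<noteq> None"
  shows "word p (ds @ a @ es) = word p (ds @ b @ es)"
proof -
  let ?s = "Abs_tangle (p, ds @ a @ es)" and ?t = "Abs_tangle (p, ds @ b @ es)"
  have "Poly_Mapping.single ?s 1 - Poly_Mapping.single ?t 1 \<in> skein_relators"
    by (rule skein_relators.isotopy[OF _ _ assms(1)])
      (use assms in \<open>simp_all add: Abs_tangle_inverse\<close>)
  then have "skein_of ?s = skein_of ?t"
    unfolding skein_of_def skein.abs_eq_iff skein_equiv_def by (rule free.span_base)
  then show ?thesis
    by (simp only: word_def assms(2,3) if_False)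
qed

text \<open>Lists that do not fit denote 0, so no side condition is required once it is known that
  the two lists fit simultaneously.\<close>

lemma word_exchange:
  "word p (ds @ (i, g) # (i + lower_legs g + d, h) # es)
    = word p (ds @ (i + upper_legs g + d, h) # (i, g) # es)"
proof (cases "strands_below p ds")
  case None
  then show ?thesis
    by (simp add: word_def strands_below_append)
next
  case (Some q)
  have eq: "strands_below q ((i, g) # (i + lower_legs g + d, h) # es)
      = strands_below q ((i + upper_legs g + d, h) # (i, g) # es)"
  proof (cases "i + upper_legs g + d + upper_legs h \<le> q")
    case True
    then have "q - upper_legs g + lower_legs g - upper_legs h + lower_legs h
        = q - upper_legs h + lower_legs h - upper_legs g + lower_legs g"
      by simp
    with True show ?thesis
      by auto
  qed auto
  show ?thesis
  proof (cases "strands_below p (ds @ (i, g) # (i + lower_legs g + d, h) # es) = None")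
    case True
    with Some eq show ?thesis
      by (simp add: word_def strands_below_append)
  next
    case False
    with Some eq show ?thesis
      using word_move[OF move.exchange[of i g d h], of p ds es]
      by (simp add: strands_below_append)
  qed
qed

text \<open>The slice passes the slices of \<open>es\<close> one at a time. Above it
  \<open>es\<close> lies to the right of q strands, below it to the right of
  \<open>q - upper_legs g + lower_legs g\<close> strands, whence the two shifts.\<close>

lemma word_slide_slice:
  assumes "i + upper_legs g \<le> q"
  shows "word p (us @ (i, g) # map (apfst ((+) (q - upper_legs g + lower_legs g))) es @ vs)
    = word p (us @ map (apfst ((+) q)) es @ (i, g) # vs)"
proof (induction es arbitrary: us)
  case (Cons e es)
  obtain j h where e: "e = (j, h)"
    by fastforce
  \<comment> \<open>The number of strands between the two pieces.\<close>
  define d where "d = q - upper_legs g - i + j"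
  have *: "q - upper_legs g + lower_legs g + j = i + lower_legs g + d"
    "q + j = i + upper_legs g + d"
    using assms by (simp_all add: d_def)
  show ?case
    using Cons[of "us @ [(q + j, h)]"] word_exchange[of p us i g d h]
    by (simp add: e *)
qed simp

lemma word_slide:
  assumes "strands_below q ds = Some r"
  shows "word p (us @ ds @ map (apfst ((+) r)) es @ vs)
    = word p (us @ map (apfst ((+) q)) es @ ds @ vs)"
  using assms
proof (induction ds arbitrary: us q)
  case (Cons d ds)
  obtain i g where d: "d = (i, g)"
    by fastforce
  have le: "i + upper_legs g \<le> q"
    and sb: "strands_below (q - upper_legs g + lower_legs g) ds = Some r"
    using Cons.prems by (auto simp: d split: if_splits)
  show ?case
    using Cons.IH[OF sb, of "us @ [(i, g)]"] word_slide_slice[OF le, of p us es "ds @ vs"]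
    by (simp add: d)
qed simp

text \<open>Distant pieces change height freely. The offset of y depends on whether y is below x,
  where x has become q strands, or above it, where x still has p strands.\<close>

lemma exchange:
  assumes "x \<in> skein_module p q" "y \<in> skein_module r s"
  shows "pad i x (d + r + j) \<fatsemi> pad (i + q + d) y j = pad (i + p + d) y j \<fatsemi> pad i x (d + s + j)"
  using assms(1)
proof (induction rule: skein_module_induct)
  case (basis t)
  from assms(2) show ?case
  proof (induction rule: skein_module_induct)
    case (basis u)
    let ?P = "\<lambda>i t j. beside (strands_tangle i) (beside t (strands_tangle j))"
    have *: "pad i (skein_of t) j = skein_of (?P i t j)" for i j t
      by (simp add: pad_def strands_def skein_of_next_to)
    note [simp] = \<open>upper t = p\<close> \<open>lower t = q\<close> \<open>upper u = r\<close> \<open>lower u = s\<close>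
    have "word (i + p + d + r + j) ([] @ map (apfst ((+) i)) (snd (Rep_tangle t))
          @ map (apfst ((+) (i + q + d))) (snd (Rep_tangle u)) @ [])
        = word (i + p + d + r + j) ([] @ map (apfst ((+) (i + p + d))) (snd (Rep_tangle u))
          @ map (apfst ((+) i)) (snd (Rep_tangle t)) @ [])"
      using strands_below_right[of p "snd (Rep_tangle t)" q d] strands_below_Rep[of t]
        strands_below_shift[of i "p + d" "snd (Rep_tangle t)"]
      by (intro word_slide) (simp add: add.assoc)
    then show ?case
      unfolding * skein_of_above
      by (simp add: skein_of_eq_word upper_stack upper_beside lower_beside Rep_stack Rep_beside
          add.assoc)
  qed (simp_all add: skein_linear pad_linear)
qed (simp_all add: skein_linear pad_linear)

section \<open>Maxima, minima and closed loops\<close>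

abbreviation cap :: skein
  where "cap \<equiv> skein_of cap_tangle"

abbreviation cup :: skein
  where "cup \<equiv> skein_of cup_tangle"

lemma pad_cap: "pad i cap j = word (i + j) [(i, Cap)]"
  unfolding pad_def strands_def skein_of_next_to
  unfolding skein_of_eq_word
  by (simp add: upper_beside Rep_beside cap_tangle.rep_eq upper.rep_eq)

lemma pad_cup: "pad i cup j = word (i + 2 + j) [(i, Cup)]"
  unfolding pad_def strands_def skein_of_next_to
  unfolding skein_of_eq_word
  by (simp add: upper_beside Rep_beside cup_tangle.rep_eq upper.rep_eq add.commute[of j])

lemma strands_eq_word: "strands n = word n []"
  by (simp add: strands_def skein_of_eq_word)

lemma word_above:
  assumes "strands_below p ds = Some q"
  shows "word p ds \<fatsemi> word q es = word p (ds @ es)"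
proof (cases "strands_below q es")
  case None
  then show ?thesis
    using assms by (simp add: word_def strands_below_append)
next
  case (Some r)
  then show ?thesis
    using assms
    by (simp add: word_def strands_below_append skein_of_above lower.rep_eq upper.rep_eq
      Abs_tangle_inverse stack.abs_eq eq_onp_def)
qed

lemma zigzag_left: "pad i cap (Suc j) \<fatsemi> pad (Suc i) cup j = strands (i + j + 1)"
  using word_move[OF move.straighten_left[of i], of "i + j + 1" "[]" "[]"]
  by (simp add: pad_cap pad_cup strands_eq_word word_above)

lemma zigzag_right: "pad (Suc i) cap j \<fatsemi> pad i cup (Suc j) = strands (i + j + 1)"
  using word_move[OF move.straighten_right[of i], of "i + j + 1" "[]" "[]"]
  by (simp add: pad_cap pad_cup strands_eq_word word_above)

lemma circle: "pad i cap j \<fatsemi> pad i cup j = (- (varA powi 2 + varA powi (- 2))) *\<^sub>K strands (i + j)"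
proof -
  let ?s = "Abs_tangle (i + j, [(i, Cap), (i, Cup)])" and ?t = "Abs_tangle (i + j, [])"
  have "Poly_Mapping.single ?s 1
        - Poly_Mapping.single ?t (- (varA powi 2 + varA powi (- 2))) \<in> skein_relators"
    by (rule skein_relators.circle[where ds = "[]" and es = "[]"])
      (simp_all add: Abs_tangle_inverse)
  then have "skein_of ?s = (- (varA powi 2 + varA powi (- 2))) *\<^sub>K skein_of ?t"
    unfolding skein_of_def scale_skein.abs_eq cmul_single skein.abs_eq_iff skein_equiv_def
    by (simp add: free.span_base)
  moreover have "pad i cap j \<fatsemi> pad i cup j = word (i + j) [(i, Cap), (i, Cup)]"
    by (simp add: pad_cap pad_cup word_above)
  ultimately show ?thesis
    by (simp add: strands_eq_word word_def)
qed


section \<open>Quantum integers\<close>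

text \<open>With \<open>q = - A\<^sup>2\<close> the sign in \<open>Delta\<close> is absorbed: \<open>qint x\<close> is the usual quantum integer
  \<open>[x]\<close> at \<open>q\<close>.\<close>

definition qint :: "int \<Rightarrow> ratfun"
  where "qint x = Delta (x - 1)"

lemma varA_neq_0 [simp]: "varA \<noteq> 0"
  by (simp add: varA_def Zero_fract_def eq_fract)

lemma varA_power: "varA ^ n = Fract (monom 1 n) 1"
  by (induction n)
    (simp_all add: varA_def One_fract_def monom_0 monom_Suc one_pCons)

text \<open>The indeterminate is not a root of unity; this makes the quantum integers at positive
  arguments invertible.\<close>

lemma varA_power_neq_1: "n > 0 \<Longrightarrow> varA ^ n \<noteq> 1"
proof
  assume "n > 0" "varA ^ n = 1"
  then have "monom 1 n = (1 :: rat poly)"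
    by (simp add: varA_power One_fract_def eq_fract)
  then have "degree (monom (1 :: rat) n) = 0"
    by simp
  with \<open>n > 0\<close> show False
    by (simp add: degree_monom_eq)
qed

abbreviation qpar :: ratfun
  where "qpar \<equiv> - (varA ^ 2)"

lemma qpar_powi: "qpar powi x = (-1) powi x * varA powi (2 * x)"
proof -
  have "qpar powi x = (-1) powi x * (varA ^ 2) powi x"
    by (subst power_int_mult_distrib[symmetric]) simp
  then show ?thesis
    by (simp add: power_int_mult)
qed

lemma qpar_powi_neq:
  assumes "x > 0"
  shows "qpar powi x \<noteq> qpar powi (- x)"
proof
  assume eq: "qpar powi x = qpar powi (- x)"
  have "qpar powi (x + x) = qpar powi x * qpar powi x"
    by (subst power_int_add) auto
  also have "\<dots> = qpar powi x * qpar powi (- x)"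
    by (simp only: flip: eq)
  also have "\<dots> = 1"
    by (subst power_int_add[symmetric]) auto
  finally have "varA powi (2 * (x + x)) = 1"
    unfolding qpar_powi by (simp add: power_int_minus_left)
  moreover have "varA powi (2 * (x + x)) = varA ^ nat (2 * (x + x))"
    using assms by (simp add: power_int_def)
  ultimately show False
    using varA_power_neq_1[of "nat (2 * (x + x))"] assms by simp
qed

lemma qint_eq: "qint x = (qpar powi x - qpar powi (- x)) / (qpar - inverse qpar)"
proof -
  define w where "w = varA powi 2 - varA powi (- 2)"
  have "qpar - inverse qpar = - w"
    by (simp add: w_def power_int_minus)
  moreover have "(-1 :: ratfun) powi (x - 1) = - ((-1) powi x)"
    by (simp add: power_int_diff)
  moreover have "(-1 :: ratfun) powi (- x) = (-1) powi x"
    by (simp add: power_int_minus_left)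
  ultimately show ?thesis
    unfolding qint_def Delta_def qpar_powi w_def[symmetric]
    by (simp add: right_diff_distrib diff_divide_distrib)
qed

lemma qpar_diff_neq_0: "qpar - inverse qpar \<noteq> 0"
  using qpar_powi_neq[of 1] by (simp add: power_int_minus)

lemma qint_neq_0: "x > 0 \<Longrightarrow> qint x \<noteq> 0"
  using qpar_powi_neq[of x] qpar_diff_neq_0 by (simp add: qint_eq)

lemma qint_0 [simp]: "qint 0 = 0"
  by (simp add: qint_eq)

lemma qint_1 [simp]: "qint 1 = 1"
  using qpar_diff_neq_0 by (simp add: qint_eq power_int_minus)

text \<open>The deformation of \<open>l (M - i) = (l - i) M + i (M - l)\<close>. Clearing
  denominators leaves a Laurent polynomial identity in the powers of q with exponents l, i and M.
  Every later three-term relation between quantum integers is an instance.\<close>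

lemma qint_mult: "qint l * qint (M - i) = qint (l - i) * qint M + qint i * qint (M - l)"
proof -
  have *: "(a - inverse a) * (m / b - b / m) = (a / b - b / a) * (m - inverse m)
      + (b - inverse b) * (m / a - a / m)"
    if "a \<noteq> 0" "b \<noteq> 0" "m \<noteq> 0" for a b m :: ratfun
    using that by (simp add: field_simps)
  define w where "w = qpar - inverse qpar"
  have w: "w \<noteq> 0"
    unfolding w_def by (rule qpar_diff_neq_0)
  have powi: "qpar powi (x - y) = qpar powi x / qpar powi y" "qpar powi (- x) = inverse (qpar powi x)"
      "qpar powi x \<noteq> 0" for x y
    by (auto simp: power_int_diff power_int_minus)
  have "w * qint x = qpar powi x - qpar powi (- x)" for x
    unfolding qint_eq w_def[symmetric] using w by simp
  then have "(w * qint l) * (w * qint (M - i))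
      = (w * qint (l - i)) * (w * qint M) + (w * qint i) * (w * qint (M - l))"
    using *[of "qpar powi l" "qpar powi i" "qpar powi M"] by (simp add: powi)
  then have "(w * w) * (qint l * qint (M - i))
      = (w * w) * (qint (l - i) * qint M + qint i * qint (M - l))"
    by (simp add: algebra_simps)
  with w show ?thesis
    by simp
qed

lemma qint_2: "qint 2 = - (varA powi 2 + varA powi (- 2))"
proof -
  have "qint 2 = qpar + inverse qpar"
    using qpar_diff_neq_0 by (simp add: qint_eq power_int_minus field_simps power2_eq_square)
  then show ?thesis
    by (simp add: power_int_minus)
qed

text \<open>The loop value minus a coefficient of Wenzl's recursion; the result is the factor that
  appears when one strand of a box is closed up.\<close>

lemma qint_Suc_div: "x > 0 \<Longrightarrow> qint 2 - qint (x - 1) / qint x = qint (x + 1) / qint x"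
  using qint_mult[of 2 "x + 1" 1] qint_neq_0[of x] by (simp add: field_simps)


section \<open>The coefficients\<close>

definition falling_qfact :: "int \<Rightarrow> nat \<Rightarrow> ratfun"
  where "falling_qfact x n = (\<Prod>j<n. qint (x - int j))"

lemma falling_qfact_0 [simp]: "falling_qfact x 0 = 1"
  by (simp add: falling_qfact_def)

lemma falling_qfact_Suc: "falling_qfact x (Suc n) = falling_qfact x n * qint (x - int n)"
  by (simp add: falling_qfact_def)

lemma falling_qfact_Suc_shift: "falling_qfact x (Suc n) = qint x * falling_qfact (x - 1) n"
  unfolding falling_qfact_def prod.lessThan_Suc_shift by (simp add: diff_diff_eq)

lemma falling_qfact_eq_0: "m < n \<Longrightarrow> falling_qfact (int m) n = 0"
  unfolding falling_qfact_def by (rule prod_zero) (auto intro!: bexI[of _ m])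

definition qfact :: "nat \<Rightarrow> ratfun"
  where "qfact n = (\<Prod>j<n. qint (int j + 1))"

lemma qfact_0 [simp]: "qfact 0 = 1" and qfact_Suc: "qfact (Suc n) = qfact n * qint (int n + 1)"
  by (simp_all add: qfact_def)

lemma qfact_neq_0 [simp]: "qfact n \<noteq> 0"
  by (simp add: qfact_def qint_neq_0)

text \<open>Each factor of the Pochhammer symbol is \<open>1 - q ^ (2 (n + 1))\<close>, which is
  \<open>- q ^ (n + 1)\<close> times the difference on the left of \<open>c\<close>. Later
  \<open>c\<close> is the sequence of quantum integers and \<open>w\<close> their common
  denominator.\<close>

lemma qpoch_square:
  fixes q w :: ratfun
  assumes "q \<noteq> 0" and c: "\<And>n. q ^ Suc n - inverse (q ^ Suc n) = w * c n"
  shows "qpoch (q * q) (q * q) n = (- w) ^ n * q ^ (\<Sum>j<n. Suc j) * (\<Prod>j<n. c j)"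
proof (induction n)
  case (Suc n)
  have "(q * q) * (q * q) ^ n = q ^ Suc n * q ^ Suc n"
    by (simp add: power_mult_distrib)
  moreover have "q ^ Suc n * (q ^ Suc n - inverse (q ^ Suc n)) = q ^ Suc n * q ^ Suc n - 1"
    using assms(1) by (simp add: right_diff_distrib field_simps)
  ultimately have "1 - (q * q) * (q * q) ^ n = - (q ^ Suc n * (w * c n))"
    unfolding c by simp
  with Suc show ?case
    by (simp add: qpoch_def power_add)
qed (simp add: qpoch_def)

lemma symmetric_qbinom:
  fixes q w :: ratfun
  assumes q: "q \<noteq> 0" and w: "w \<noteq> 0" and c: "\<And>n. q ^ Suc n - inverse (q ^ Suc n) = w * c n"
  shows "q powi (int i * (int i - int (i + d))) * qbinom (q * q) (i + d) i
    = (\<Prod>j<i + d. c j) / ((\<Prod>j<i. c j) * (\<Prod>j<d. c j))"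
proof -
  \<comment> \<open>The exponents are triangular numbers. Their defect \<open>i * d\<close> is
    exactly cancelled by the prefactor, whose exponent is
    \<open>i (i - (i + d)) = - i d\<close>.\<close>
  have sums: "(\<Sum>j<i + d. Suc j) = (\<Sum>j<i. Suc j) + (\<Sum>j<d. Suc j) + i * d"
    by (induction d) simp_all
  have "int i * (int i - int (i + d)) = - int (i * d)"
    by (simp add: algebra_simps)
  then have "q powi (int i * (int i - int (i + d))) = inverse (q ^ (i * d))"
    by (simp only: power_int_minus power_int_of_nat)
  then show ?thesis
    unfolding qbinom_def qpoch_square[OF q c] sums
    using q w by (simp add: power_add)
qed

text \<open>Since \<open>A\<^sup>4 = q\<^sup>2\<close>, the prefactor turns the Gaussian binomial into the symmetric one.\<close>

lemma qbinom_eq: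
  "qpar powi (int i * (int i - int (i + d))) * qbinom (varA ^ 4) (i + d) i
    = qfact (i + d) / (qfact i * qfact d)"
proof -
  have "qpar ^ Suc n - inverse (qpar ^ Suc n) = (qpar - inverse qpar) * qint (int n + 1)" for n
  proof -
    have "int n + 1 = int (Suc n)"
      by simp
    then show ?thesis
      using qpar_diff_neq_0
      by (simp only: qint_eq power_int_minus power_int_of_nat times_divide_eq_right
          nonzero_mult_div_cancel_left not_False_eq_True)
  qed
  note factor = this
  have "varA ^ 4 = qpar * qpar"
    by (simp flip: power_add)
  then show ?thesis
    using symmetric_qbinom[OF _ qpar_diff_neq_0 factor, of i d] by (simp only: qfact_def) simp
qed

text \<open>The coefficient as a function of i and d = l - i, so that each term of the recursion
  lowers exactly one of the two. The integer arguments avoid truncation in m - 1 and n - 1.\<close>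

definition symmetric_coeff :: "int \<Rightarrow> int \<Rightarrow> int \<Rightarrow> nat \<Rightarrow> nat \<Rightarrow> ratfun"
  where "symmetric_coeff m n k i d = qfact (i + d) / (qfact i * qfact d)
    * (falling_qfact k d * (falling_qfact n i * falling_qfact m i))
    * falling_qfact (m + n + k - int i + 1) d
    / (falling_qfact (n + k) (i + d) * falling_qfact (m + k) (i + d))"

lemma bubble_coeff_eq:
  assumes "i \<le> l"
  shows "bubble_coeff m n k l i = symmetric_coeff (int m) (int n) (int k) i (l - i)"
proof -
  obtain d where l: "l = i + d"
    using assms le_Suc_ex by blast
  have "(\<Prod>j<d. Delta (int k - int j - 1)) = falling_qfact (int k) d"
    "(\<Prod>s<i. Delta (int n - int s - 1) * Delta (int m - int s - 1))
      = falling_qfact (int n) i * falling_qfact (int m) i"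
    "(\<Prod>t<l. Delta (int n + int k - int t - 1) * Delta (int m + int k - int t - 1))
      = falling_qfact (int n + int k) l * falling_qfact (int m + int k) l"
    "(\<Prod>j<d. Delta (int m + int n + int k - int i - int j))
      = falling_qfact (int m + int n + int k - int i + 1) d"
    by (simp_all add: falling_qfact_def qint_def prod.distrib algebra_simps)
  then have "bubble_coeff m n k l i = qpar powi (int i * (int i - int l))
    * ((falling_qfact (int k) d * (falling_qfact (int n) i * falling_qfact (int m) i))
      / (falling_qfact (int n + int k) l * falling_qfact (int m + int k) l))
    * qbinom (varA ^ 4) l i
    * falling_qfact (int m + int n + int k - int i + 1) d"
    using l by (simp only: bubble_coeff_def add_diff_cancel_left')
  also have "\<dots> = symmetric_coeff (int m) (int n) (int k) i d"
    unfolding symmetric_coeff_def qbinom_eq[of i d, symmetric] l by (simp only: mult_ac times_divide_eq_right times_divide_eq_left)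
  finally show ?thesis
    by (simp add: l)
qed

text \<open>For positive i and d the three coefficients share the factor \<open>N / D\<close>, and
  an identity between products of two quantum integers remains. If i or d is 0, a single term
  survives on the right and agrees with the left side factor by factor.\<close>

lemma symmetric_coeff_rec:
  fixes m n k :: int
  defines "w \<equiv> qint (m + k + 1) * qint (n + k + 1)"
  assumes "i + d > 0"
  shows "symmetric_coeff m n (k + 1) i d
    = (if d = 0 then 0 else qint (k + 1) * qint (m + n + k + 2) / w * symmetric_coeff m n k i (d - 1))
    + (if i = 0 then 0 else qint m * qint n / w * symmetric_coeff (m - 1) (n - 1) (k + 1) (i - 1) d)"
proof -
  note shift = falling_qfact_Suc_shift
  have denom: "falling_qfact (x + (k + 1)) (Suc j) = qint (x + k + 1) * falling_qfact (x + k) j"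
    "falling_qfact (x - 1 + (k + 1)) j = falling_qfact (x + k) j" for x j
    by (simp_all add: shift add_ac)
  show ?thesis
  proof (cases i; cases d)
    fix i' assume i: "i = Suc i'" and d: "d = 0"
    have "falling_qfact n (Suc i') = qint n * falling_qfact (n - 1) i'"
      "falling_qfact m (Suc i') = qint m * falling_qfact (m - 1) i'"
      by (rule shift)+
    then show ?thesis
      unfolding symmetric_coeff_def by (simp add: d i denom w_def mult_ac)
  next
    fix d' assume i: "i = 0" and d: "d = Suc d'"
    have "falling_qfact (k + 1) d = qint (k + 1) * falling_qfact k d'"
      "falling_qfact (m + n + (k + 1) - int i + 1) d
        = qint (m + n + k + 2) * falling_qfact (m + n + k - int i + 1) d'"
      by (simp_all add: i d shift algebra_simps)
    then show ?thesis
      unfolding symmetric_coeff_def by (simp add: d i denom w_def mult_ac)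
  next
    fix i' d' assume i: "i = Suc i'" and d: "d = Suc d'"
    define F where "F = falling_qfact (m + n + k - int i') d'"
    define N where "N = falling_qfact k d' * falling_qfact (n - 1) i' * falling_qfact (m - 1) i'
      * qint (k + 1) * qint n * qint m * F * qfact (Suc (i' + d'))"
    define D where "D = qfact i' * qint (int i' + 1) * (qfact d' * qint (int d' + 1)) *
      (w * falling_qfact (n + k) (Suc (i' + d')) * falling_qfact (m + k) (Suc (i' + d')))"
    have nz: "qint (int i' + 1) \<noteq> 0" "qint (int d' + 1) \<noteq> 0"
      by (simp_all add: qint_neq_0)
    have facts: "qfact i = qfact i' * qint (int i' + 1)" "qfact d = qfact d' * qint (int d' + 1)"
        "qfact (i + d) = qfact (Suc (i' + d')) * qint (int i' + int d' + 2)"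
        "qfact (i + d') = qfact (Suc (i' + d'))" "qfact (i' + d) = qfact (Suc (i' + d'))"
      by (simp_all add: i d qfact_Suc add_ac)
    have tops: "falling_qfact (k + 1) d = qint (k + 1) * falling_qfact k d'"
        "falling_qfact n i = qint n * falling_qfact (n - 1) i'"
        "falling_qfact m i = qint m * falling_qfact (m - 1) i'"
        "falling_qfact (m + n + (k + 1) - int i + 1) d = qint (m + n + k + 1 - int i') * F"
        "falling_qfact (m + n + k - int i + 1) d' = F"
      by (simp_all add: i d shift F_def algebra_simps)
    have bot: "falling_qfact (m - 1 + (n - 1) + (k + 1) - int i' + 1) d
        = F * qint (m + n + k - int i' - int d')"
      unfolding d falling_qfact_Suc F_def by (simp add: algebra_simps)
    have denoms: "falling_qfact (x + (k + 1)) (i + d)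
          = qint (x + k + 1) * falling_qfact (x + k) (Suc (i' + d'))"
        "falling_qfact (x + k) (i + d') = falling_qfact (x + k) (Suc (i' + d'))"
        "falling_qfact (x - 1 + (k + 1)) (i' + d) = falling_qfact (x + k) (Suc (i' + d'))" for x
      using denom(1)[of x "Suc (i' + d')"] denom(2)[of x "Suc (i' + d')"] by (simp_all add: i d)
    have 0: "symmetric_coeff m n (k + 1) i d
        = N * (qint (int i' + int d' + 2) * qint (m + n + k + 1 - int i')) / D"
      unfolding symmetric_coeff_def facts tops denoms N_def D_def w_def
      by (simp add: mult_ac)
    have 1: "qint (k + 1) * qint (m + n + k + 2) / w * symmetric_coeff m n k i d'
        = N * (qint (int d' + 1) * qint (m + n + k + 2)) / D"
      unfolding symmetric_coeff_def facts tops denoms N_def D_def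
      using nz by (simp add: mult_ac)
    have 2: "qint m * qint n / w * symmetric_coeff (m - 1) (n - 1) (k + 1) i' d
        = N * (qint (int i' + 1) * qint (m + n + k - int i' - int d')) / D"
      unfolding symmetric_coeff_def facts tops bot denoms N_def D_def
      using nz by (simp add: mult_ac)
    \<comment> \<open>This is \<open>qint_mult\<close> with \<open>l = i + d\<close> and
      \<open>M = m + n + k + 2\<close>, where i = i' + 1 and d = d' + 1.\<close>
    have key: "qint (int i' + int d' + 2) * qint (m + n + k + 1 - int i')
        = qint (int d' + 1) * qint (m + n + k + 2) + qint (int i' + 1) * qint (m + n + k - int i' - int d')"
      using qint_mult[of "int i' + int d' + 2" "m + n + k + 2" "int i' + 1"]
      by (simp add: algebra_simps)
    have "i \<noteq> 0" "d \<noteq> 0" "i - 1 = i'" "d - 1 = d'"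
      by (simp_all add: i d)
    then show ?thesis
      by (simp only: 0 1 2 key if_False add_divide_distrib distrib_left)
  qed (use assms in simp)
qed


section \<open>Jones--Wenzl idempotents\<close>

text \<open>The strands acted upon are those of the generators \<open>e 0, \<dots>, e (n - 2)\<close>. For \<open>n = 0\<close> the
  coefficient in the recursion vanishes.\<close>

primrec jw_of :: "skein \<Rightarrow> (nat \<Rightarrow> skein) \<Rightarrow> nat \<Rightarrow> skein"
  where
    "jw_of u e 0 = u"
  | "jw_of u e (Suc n) = jw_of u e n
      - (qint (int n) / qint (int n + 1)) *\<^sub>K (jw_of u e n \<fatsemi> e (n - 1) \<fatsemi> jw_of u e n)"

lemma jw_of_cong: "(\<And>i. i + 1 < n \<Longrightarrow> e i = e' i) \<Longrightarrow> jw_of u e n = jw_of u e' n"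
proof (induction n)
  case (Suc n)
  then show ?case
    by (cases n) simp_all
qed simp

text \<open>The Temperley-Lieb relations are separated from diagrams so that one theory serves the
  generators in order, in reverse order, and without the first one. M counts generators, so the full
  idempotent is the one on M + 1 strands.\<close>

locale tl_generators =
  fixes u :: skein and e :: "nat \<Rightarrow> skein" and M :: nat
  assumes unit: "u \<fatsemi> u = u" "i < M \<Longrightarrow> u \<fatsemi> e i = e i" "i < M \<Longrightarrow> e i \<fatsemi> u = e i"
    and square: "i < M \<Longrightarrow> e i \<fatsemi> e i = qint 2 *\<^sub>K e i"
    and far: "i + 2 \<le> j \<Longrightarrow> j < M \<Longrightarrow> e i \<fatsemi> e j = e j \<fatsemi> e i"
    and near_Suc: "Suc i < M \<Longrightarrow> e i \<fatsemi> e (Suc i) \<fatsemi> e i = e i"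
    and Suc_near: "Suc i < M \<Longrightarrow> e (Suc i) \<fatsemi> e i \<fatsemi> e (Suc i) = e (Suc i)"
begin

abbreviation jw where "jw \<equiv> jw_of u e"

lemma unit_jw: "n \<le> Suc M \<Longrightarrow> u \<fatsemi> jw n = jw n" "n \<le> Suc M \<Longrightarrow> jw n \<fatsemi> u = jw n"
proof (induction n)
  case (Suc n)
  {
    case 1
    then have "u \<fatsemi> jw n = jw n"
      using Suc by simp
    moreover from this have "u \<fatsemi> jw n \<fatsemi> x = jw n \<fatsemi> x" for x
      by (metis above_assoc)
    ultimately show ?case
      by (simp add: skein_linear above_assoc)
  next
    case 2
    then show ?case
      using Suc by (simp add: skein_linear above_assoc)
  }
qed (simp_all add: unit)

text \<open>\<open>jw n\<close> is built from generators of index at most n - 2, all of which are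
  far from \<open>e j\<close>.\<close>

lemma jw_commute: "n \<le> j \<Longrightarrow> j < M \<Longrightarrow> jw n \<fatsemi> e j = e j \<fatsemi> jw n"
proof (induction n)
  case 0
  then show ?case
    by (simp add: unit)
next
  case (Suc n)
  show ?case
  proof (cases n)
    case 0
    then show ?thesis
      using Suc.prems by (simp add: unit)
  next
    case (Suc n')
    have com: "jw n \<fatsemi> e j = e j \<fatsemi> jw n" "e (n - 1) \<fatsemi> e j = e j \<fatsemi> e (n - 1)"
      using Suc.IH Suc.prems far[of "n - 1" j] by (simp_all add: Suc del: jw_of.simps)
    have "jw n \<fatsemi> e j \<fatsemi> x = e j \<fatsemi> jw n \<fatsemi> x" "e (n - 1) \<fatsemi> e j \<fatsemi> x = e j \<fatsemi> e (n - 1) \<fatsemi> x" for x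
      by (simp_all only: com flip: above_assoc)
    with com show ?thesis
      by (simp add: skein_linear above_assoc)
  qed
qed

text \<open>Annihilation by the newest generator rests on the formula for the previous idempotent
  between two copies of that generator, and this formula in turn rests on idempotence one stage
  earlier. Hence a single simultaneous induction.\<close>

lemma jw_properties:
  assumes "n \<le> M"
  shows "(\<forall>j<n. jw (Suc n) \<fatsemi> e j = 0) \<and> (\<forall>j<n. e j \<fatsemi> jw (Suc n) = 0)
    \<and> jw (Suc n) \<fatsemi> jw (Suc n) = jw (Suc n)
    \<and> jw (Suc n) \<fatsemi> jw n = jw (Suc n) \<and> jw n \<fatsemi> jw (Suc n) = jw (Suc n)
    \<and> (n < M \<longrightarrow> e n \<fatsemi> jw (Suc n) \<fatsemi> e n = (qint (int n + 2) / qint (int n + 1)) *\<^sub>K (jw n \<fatsemi> e n))"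
  using assms
proof (induction n)
  case 0
  then show ?case
    by (auto simp: unit square)
next
  case (Suc n)
  define f g where "f = jw (Suc n)" and "g = jw (Suc (Suc n))"
  define c where "c = qint (int n + 1) / qint (int n + 2)"
  have g: "g = f - c *\<^sub>K (f \<fatsemi> e n \<fatsemi> f)"
    by (simp add: f_def g_def c_def algebra_simps)
  have nM: "n < M"
    using Suc.prems by simp
  have kill: "f \<fatsemi> e j = 0" "e j \<fatsemi> f = 0" if "j < n" for j
    using Suc that by (simp_all add: f_def del: jw_of.simps)
  have ff: "f \<fatsemi> f = f" and fn: "f \<fatsemi> jw n = f" "jw n \<fatsemi> f = f"
    and tr: "e n \<fatsemi> f \<fatsemi> e n = (1 / c) *\<^sub>K (jw n \<fatsemi> e n)"
    using Suc nM by (simp_all add: f_def c_def del: jw_of.simps)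
  have c: "c \<noteq> 0"
    using qint_neq_0[of "int n + 1"] qint_neq_0[of "int n + 2"] by (simp add: c_def)
  have commute: "jw n \<fatsemi> e n = e n \<fatsemi> jw n"
    using jw_commute[of n n] nM by simp
  have ff': "f \<fatsemi> f \<fatsemi> x = f \<fatsemi> x" for x
    using ff by (simp flip: above_assoc)
  \<comment> \<open>The sandwich formula contributes \<open>1 / c\<close>, the inverse of the
    coefficient in the recursion, so the two terms of \<open>g\<close> cancel when multiplied by
    \<open>e n\<close>.\<close>
  have "f \<fatsemi> e n \<fatsemi> f \<fatsemi> e n = (1 / c) *\<^sub>K (f \<fatsemi> e n)"
    by (simp add: tr skein_linear) (metis above_assoc fn(1))
  then have gn: "g \<fatsemi> e n = 0"
    using c by (simp add: g skein_linear above_assoc)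
  have "e n \<fatsemi> f \<fatsemi> e n \<fatsemi> f = (1 / c) *\<^sub>K (e n \<fatsemi> f)"
    by (metis above_assoc above_scale_left tr commute fn(2))
  then have ng: "e n \<fatsemi> g = 0"
    using c by (simp add: g skein_linear above_assoc)
  have gf: "g \<fatsemi> f = g" and fg: "f \<fatsemi> g = g"
    by (simp_all add: g skein_linear above_assoc ff ff')
  have "g \<fatsemi> f \<fatsemi> e n \<fatsemi> f = 0"
    by (metis above_assoc above_zero_left gf gn)
  then have gg: "g \<fatsemi> g = g"
    by (subst (2) g) (simp add: skein_linear gf)
  have "g \<fatsemi> e j = 0 \<and> e j \<fatsemi> g = 0" if "j < Suc n" for j
  proof (cases "j = n")
    case False
    with that have "j < n"
      by simp
    have "e j \<fatsemi> f \<fatsemi> x = 0" for x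
      using kill[OF \<open>j < n\<close>] by (simp flip: above_assoc)
    with kill[OF \<open>j < n\<close>] show ?thesis
      by (simp add: g skein_linear above_assoc)
  qed (simp add: gn ng)
  moreover have "e (Suc n) \<fatsemi> g \<fatsemi> e (Suc n)
      = (qint (int n + 3) / qint (int n + 2)) *\<^sub>K (f \<fatsemi> e (Suc n))" if "Suc n < M"
  proof -
    have com: "f \<fatsemi> e (Suc n) = e (Suc n) \<fatsemi> f"
      unfolding f_def by (rule jw_commute) (use that in auto)
    then have com': "e (Suc n) \<fatsemi> f \<fatsemi> x = f \<fatsemi> e (Suc n) \<fatsemi> x" for x
      by (simp flip: above_assoc)
    \<comment> \<open>Since \<open>f\<close> commutes with \<open>e (Suc n)\<close>, the two outer
      generators can be moved next to \<open>e n\<close>, where the three collapse to one.\<close>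
    have "e (Suc n) \<fatsemi> f \<fatsemi> e n \<fatsemi> f \<fatsemi> e (Suc n) = f \<fatsemi> (e (Suc n) \<fatsemi> e n \<fatsemi> e (Suc n)) \<fatsemi> f"
      by (simp add: com com' above_assoc)
    also have "\<dots> = f \<fatsemi> e (Suc n)"
      by (simp add: Suc_near[OF that] com' ff ff' flip: com)
    finally have "e (Suc n) \<fatsemi> g \<fatsemi> e (Suc n) = (qint 2 - c) *\<^sub>K (f \<fatsemi> e (Suc n))"
      using that by (simp add: g skein_linear above_assoc com' square skein.scale_left_diff_distrib)
    also have "qint 2 - c = qint (int n + 3) / qint (int n + 2)"
      using qint_Suc_div[of "int n + 2"] by (simp add: c_def add.commute)
    finally show ?thesis .
  qed
  ultimately show ?case
    using gg gf fg by (simp add: f_def g_def algebra_simps del: jw_of.simps)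
qed

lemma
  shows jw_kill: "j < M \<Longrightarrow> jw (Suc M) \<fatsemi> e j = 0" "j < M \<Longrightarrow> e j \<fatsemi> jw (Suc M) = 0"
    and jw_idem: "n \<le> Suc M \<Longrightarrow> jw n \<fatsemi> jw n = jw n"
  using jw_properties[of M] jw_properties[of "n - 1"] by (cases n; simp add: unit del: jw_of.simps(2))+

text \<open>\<open>jw_of u e' n\<close> is the unit plus terms that contain a generator, and these
  are annihilated by the full idempotent. This covers any arrangement of the generators, in
  particular reversals and smaller boxes.\<close>

lemma jw_absorb:
  assumes sub: "\<And>i. i + 1 < n \<Longrightarrow> e' i \<in> e ` {..<M}"
  shows "jw (Suc M) \<fatsemi> jw_of u e' n = jw (Suc M) \<and> jw_of u e' n \<fatsemi> jw (Suc M) = jw (Suc M)"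
  using sub
proof (induction n)
  case 0
  then show ?case
    by (simp add: unit_jw del: jw_of.simps(2))
next
  case (Suc n)
  show ?case
  proof (cases n)
    case 0
    then show ?thesis
      using Suc by simp
  next
    case (Suc n')
    then have "e' (n - 1) \<in> e ` {..<M}"
      by (intro Suc.prems) simp
    then have *: "jw (Suc M) \<fatsemi> e' (n - 1) = 0" "e' (n - 1) \<fatsemi> jw (Suc M) = 0"
      using jw_kill by auto
    have "jw (Suc M) \<fatsemi> jw_of u e' n = jw (Suc M)" "jw_of u e' n \<fatsemi> jw (Suc M) = jw (Suc M)"
      using Suc.IH Suc.prems by auto
    moreover from this * have "jw (Suc M) \<fatsemi> jw_of u e' n \<fatsemi> e' (n - 1) \<fatsemi> jw_of u e' n = 0"
        "jw_of u e' n \<fatsemi> e' (n - 1) \<fatsemi> jw_of u e' n \<fatsemi> jw (Suc M) = 0"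
      by (metis above_assoc above_zero_left) (metis calculation(2) *(2) above_zero_right)
    ultimately show ?thesis
      unfolding jw_of.simps(2)[of u e' n]
      by (simp add: skein_linear above_assoc del: jw_of.simps(2))
  qed
qed

lemma tl_generators_rev: "tl_generators u (\<lambda>i. e (M - 1 - i)) M"
proof
  fix i assume "Suc i < M"
  then obtain j where "M - 1 - i = Suc j" "M - 1 - Suc i = j" "Suc j < M"
    by (intro that[of "M - 1 - Suc i"]) simp_all
  then show "e (M - 1 - i) \<fatsemi> e (M - 1 - Suc i) \<fatsemi> e (M - 1 - i) = e (M - 1 - i)"
    "e (M - 1 - Suc i) \<fatsemi> e (M - 1 - i) \<fatsemi> e (M - 1 - Suc i) = e (M - 1 - Suc i)"
    by (simp_all add: near_Suc Suc_near)
next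
  fix i j assume "i + 2 \<le> j" "j < M"
  then show "e (M - 1 - i) \<fatsemi> e (M - 1 - j) = e (M - 1 - j) \<fatsemi> e (M - 1 - i)"
    by (intro far[symmetric]) auto
qed (simp_all add: unit square)

text \<open>An idempotent killed by the generators is unique, hence invariant under reversing them.\<close>

lemma jw_rev: "jw_of u (\<lambda>i. e (M - 1 - i)) (Suc M) = jw (Suc M)"
proof -
  interpret rev: tl_generators u "\<lambda>i. e (M - 1 - i)" M
    by (rule tl_generators_rev)
  have "jw (Suc M) \<fatsemi> rev.jw (Suc M) = jw (Suc M)"
    using jw_absorb[of "Suc M" "\<lambda>i. e (M - 1 - i)"] by auto
  moreover have "e i \<in> (\<lambda>i. e (M - 1 - i)) ` {..<M}" if "i < M" for i
    using that by (intro image_eqI[of _ _ "M - 1 - i"]) auto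
  then have "jw (Suc M) \<fatsemi> rev.jw (Suc M) = rev.jw (Suc M)"
    using rev.jw_absorb[of "Suc M" e] by auto
  ultimately show ?thesis
    by metis
qed

end

text \<open>The reversed recursion ends with \<open>e 0\<close>. Its stage before that is the
  recursion along \<open>e K, ..., e 1\<close>, which \<open>jw_rev\<close> puts back into
  increasing order.\<close>

lemma (in tl_generators) jw_mirror:
  assumes "M = Suc K"
  shows "jw (Suc M) = jw_of u (\<lambda>i. e (Suc i)) M - (qint (int M) / qint (int M + 1)) *\<^sub>K
    (jw_of u (\<lambda>i. e (Suc i)) M \<fatsemi> e 0 \<fatsemi> jw_of u (\<lambda>i. e (Suc i)) M)"
proof -
  interpret shift: tl_generators u "\<lambda>i. e (Suc i)" K
    by standard (auto simp: unit square near_Suc Suc_near assms intro!: far)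
  have "jw_of u (\<lambda>i. e (M - 1 - i)) M = jw_of u (\<lambda>i. e (Suc (K - 1 - i))) M"
    \<comment> \<open>Stage M of the recursion reads the indices below K, where the two truncated
      differences agree.\<close>
    by (rule jw_of_cong) (simp add: assms Suc_diff_Suc)
  also have "\<dots> = jw_of u (\<lambda>i. e (Suc i)) M"
    using shift.jw_rev by (simp only: assms)
  finally show ?thesis
    using jw_rev by simp
qed

section \<open>Diagrams as Temperley-Lieb generators\<close>

lemma skein_module_cap: "cap \<in> skein_module 0 2"
  using skein_module_basis[of cap_tangle]
  by (simp add: upper.rep_eq lower.rep_eq cap_tangle.rep_eq numeral_2_eq_2)

lemma skein_module_cup: "cup \<in> skein_module 2 0"
  using skein_module_basis[of cup_tangle]
  by (simp add: upper.rep_eq lower.rep_eq cup_tangle.rep_eq numeral_2_eq_2)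

lemma pad_cup_cap: "pad i (cup \<fatsemi> cap) j \<in> skein_module (i + 2 + j) (i + 2 + j)"
  by (rule skein_module_pad[OF skein_module_above[OF skein_module_cup skein_module_cap]]) auto

lemma zigzag_left_above:
  assumes "x \<in> skein_module (i + j + 1) q"
  shows "pad i cap (Suc j) \<fatsemi> pad (Suc i) cup j \<fatsemi> x = x"
  using zigzag_left[of i j] strands_above[OF assms] by (simp flip: above_assoc)

lemma zigzag_right_above:
  assumes "x \<in> skein_module (i + j + 1) q"
  shows "pad (Suc i) cap j \<fatsemi> pad i cup (Suc j) \<fatsemi> x = x"
  using zigzag_right[of i j] strands_above[OF assms] by (simp flip: above_assoc)

lemma pad_cap_in: "pad i cap j \<in> skein_module (i + j) (i + j + 2)"
  by (rule skein_module_pad[OF skein_module_cap]) auto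

lemma pad_cup_in: "pad i cup j \<in> skein_module (i + j + 2) (i + j)"
  by (rule skein_module_pad[OF skein_module_cup]) auto

text \<open>The square of a generator contains a closed loop, distant generators are exchanged by
  isotopy, and neighbours cancel through zigzags.\<close>

lemma tl_generators_diagrams:
  assumes "M = 0 \<or> i + M + 1 \<le> N"
  shows "tl_generators (strands N) (\<lambda>t. pad (i + t) (cup \<fatsemi> cap) (N - 2 - i - t)) M"
proof
  have in_module: "pad (i + t) (cup \<fatsemi> cap) (N - 2 - i - t) \<in> skein_module N N" if "t < M" for t
    by (rule skein_module_pad[OF skein_module_above[OF skein_module_cup skein_module_cap]])
      (use assms that in auto)
  show "strands N \<fatsemi> strands N = strands N"
    by (rule strands_above[OF strands_in_skein_module])
  fix t assume t: "t < M"
  show "strands N \<fatsemi> pad (i + t) (cup \<fatsemi> cap) (N - 2 - i - t) = pad (i + t) (cup \<fatsemi> cap) (N - 2 - i - t)"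
    by (rule strands_above[OF in_module[OF t]])
  show "pad (i + t) (cup \<fatsemi> cap) (N - 2 - i - t) \<fatsemi> strands N = pad (i + t) (cup \<fatsemi> cap) (N - 2 - i - t)"
    by (rule above_strands[OF in_module[OF t]])
  define j where "j = N - 2 - i - t"
  have "pad (i + t) cap j \<fatsemi> pad (i + t) cup j \<fatsemi> pad (i + t) cap j = qint 2 *\<^sub>K pad (i + t) cap j"
    using strands_above[OF pad_cap_in[of "i + t" j]]
    by (simp add: circle above_scale_left qint_2 flip: above_assoc)
  then show "pad (i + t) (cup \<fatsemi> cap) (N - 2 - i - t) \<fatsemi> pad (i + t) (cup \<fatsemi> cap) (N - 2 - i - t)
      = qint 2 *\<^sub>K pad (i + t) (cup \<fatsemi> cap) (N - 2 - i - t)"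
    unfolding j_def[symmetric] by (simp add: pad_above above_assoc above_scale_right)
next
  fix s t assume "s + 2 \<le> t" "t < M"
  then obtain d where t: "t = s + 2 + d"
    using le_Suc_ex by blast
  define j where "j = N - 2 - i - t"
  have N: "N - 2 - i - t = j" "N - 2 - i - s = d + 2 + j"
    using assms \<open>t < M\<close> by (simp_all add: j_def t)
  show "pad (i + s) (cup \<fatsemi> cap) (N - 2 - i - s) \<fatsemi> pad (i + t) (cup \<fatsemi> cap) (N - 2 - i - t)
      = pad (i + t) (cup \<fatsemi> cap) (N - 2 - i - t) \<fatsemi> pad (i + s) (cup \<fatsemi> cap) (N - 2 - i - s)"
    unfolding N unfolding t
    using exchange[of "cup \<fatsemi> cap" 2 2 "cup \<fatsemi> cap" 2 2 "i + s" d j]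
      skein_module_above[OF skein_module_cup skein_module_cap]
    by (simp add: algebra_simps)
next
  fix t assume t: "Suc t < M"
  define j where "j = N - 2 - i - Suc t"
  have N: "N - 2 - i - Suc t = j" "N - 2 - i - t = Suc j" "i + Suc t = Suc (i + t)"
    using assms t by (simp_all add: j_def)
  have in_module: "pad (i + t) cap (Suc j) \<in> skein_module (i + t + j + 1) N"
      "pad (Suc (i + t)) cap j \<in> skein_module (i + t + j + 1) N"
    by (rule skein_module_pad[OF skein_module_cap]; use assms t in \<open>simp add: j_def\<close>)+
  show "pad (i + t) (cup \<fatsemi> cap) (N - 2 - i - t) \<fatsemi> pad (i + Suc t) (cup \<fatsemi> cap) (N - 2 - i - Suc t)
        \<fatsemi> pad (i + t) (cup \<fatsemi> cap) (N - 2 - i - t) = pad (i + t) (cup \<fatsemi> cap) (N - 2 - i - t)"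
    "pad (i + Suc t) (cup \<fatsemi> cap) (N - 2 - i - Suc t) \<fatsemi> pad (i + t) (cup \<fatsemi> cap) (N - 2 - i - t)
        \<fatsemi> pad (i + Suc t) (cup \<fatsemi> cap) (N - 2 - i - Suc t)
      = pad (i + Suc t) (cup \<fatsemi> cap) (N - 2 - i - Suc t)"
    unfolding N
    by (simp_all add: pad_above above_assoc zigzag_left_above[OF in_module(1)]
        zigzag_right_above[OF in_module(1)] zigzag_left_above[OF in_module(2)]
        zigzag_right_above[OF in_module(2)])
qed

lemma cups_1: "cups (Suc 0) = cup" and caps_1: "caps (Suc 0) = cap"
proof -
  show "cups (Suc 0) = cup"
    using strands_above[OF skein_module_cup] by (simp add: strands_next_to_strands numeral_2_eq_2)
  show "caps (Suc 0) = cap"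
    using above_strands[OF skein_module_cap] by (simp add: strands_next_to_strands numeral_2_eq_2)
qed

lemma jones_wenzl_Suc: "jones_wenzl (Suc n) = pad 0 (jones_wenzl n) 1
  - (qint (int n) / qint (int n + 1)) *\<^sub>K
    (pad 0 (jones_wenzl n) 1 \<fatsemi> pad (n - 1) (cup \<fatsemi> cap) 0 \<fatsemi> pad 0 (jones_wenzl n) 1)"
proof (cases n)
  case 0
  then show ?thesis
    by (simp add: pad_strands)
next
  case (Suc k)
  then show ?thesis
    by (simp add: pad_def cups_1 caps_1 qint_def add.commute del: caps.simps cups.simps)
qed

text \<open>A box placed anywhere among N strands obeys the same recursion with generators shifted
  by i. Boxes of different sizes and positions thus become comparable through
  \<open>jw_absorb\<close>.\<close>

lemma pad_jones_wenzl:
  "i + n + j = N \<Longrightarrow> pad i (jones_wenzl n) j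
    = jw_of (strands N) (\<lambda>t. pad (i + t) (cup \<fatsemi> cap) (N - 2 - i - t)) n"
proof (induction n arbitrary: j)
  case 0
  then show ?case
    by (simp add: pad_strands)
next
  case (Suc n)
  \<comment> \<open>For n = 0 the positions of the generator may disagree, but its coefficient is
    \<open>qint 0\<close>.\<close>
  have "n = 0 \<or> N - 2 - i - (n - 1) = j"
    using Suc.prems by auto
  moreover have IH: "pad i (jones_wenzl n) (Suc j)
      = jw_of (strands N) (\<lambda>t. pad (i + t) (cup \<fatsemi> cap) (N - 2 - i - t)) n"
    using Suc.prems by (intro Suc.IH) simp
  ultimately show ?case
    by (subst jones_wenzl_Suc) (auto simp: pad_linear pad_above pad_pad)
qed

lemma jones_wenzl_eq_jw_of:
  "jones_wenzl n = jw_of (strands n) (\<lambda>t. pad t (cup \<fatsemi> cap) (n - 2 - t)) n"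
  using pad_jones_wenzl[of 0 n 0 n] by simp

lemma tl_generators_jones_wenzl:
  "tl_generators (strands (Suc n)) (\<lambda>t. pad t (cup \<fatsemi> cap) (Suc n - 2 - t)) n"
  using tl_generators_diagrams[of n 0 "Suc n"] by simp

lemma skein_module_jones_wenzl: "jones_wenzl n \<in> skein_module n n"
proof (induction n)
  case (Suc n)
  show ?case
  proof (cases n)
    case 0
    then show ?thesis
      by (simp add: strands_in_skein_module)
  next
    case (Suc k)
    have "pad 0 (jones_wenzl n) 1 \<in> skein_module (Suc n) (Suc n)"
      by (rule skein_module_pad[OF Suc.IH]) auto
    moreover have "pad (n - 1) (cup \<fatsemi> cap) 0 \<in> skein_module (Suc n) (Suc n)"
      using pad_cup_cap[of "n - 1" 0] Suc by simp
    ultimately show ?thesis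
      unfolding jones_wenzl_Suc[of n]
      by (intro skein_module_diff skein_module_scale skein_module_above)
  qed
qed (simp add: strands_in_skein_module)

lemma jones_wenzl_absorb:
  assumes "i + n + j = N"
  shows "jones_wenzl N \<fatsemi> pad i (jones_wenzl n) j = jones_wenzl N"
    and "pad i (jones_wenzl n) j \<fatsemi> jones_wenzl N = jones_wenzl N"
proof -
  let ?e = "\<lambda>t. pad t (cup \<fatsemi> cap) (N - 2 - t)"
  have "jones_wenzl N \<fatsemi> pad i (jones_wenzl n) j = jones_wenzl N \<and>
    pad i (jones_wenzl n) j \<fatsemi> jones_wenzl N = jones_wenzl N"
  proof (cases N)
    case 0
    then show ?thesis
      using assms strands_above[OF strands_in_skein_module] by simp
  next
    case (Suc M)
    interpret tl_generators "strands N" ?e M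
      using tl_generators_jones_wenzl[of M] Suc by simp
    have "jones_wenzl N = jw (Suc M)"
      using jones_wenzl_eq_jw_of[of N] by (simp only: Suc)
    then show ?thesis
      unfolding pad_jones_wenzl[OF assms]
      using jw_absorb[of n "\<lambda>t. pad (i + t) (cup \<fatsemi> cap) (N - 2 - i - t)"] assms Suc
      by (auto simp del: jw_of.simps)
  qed
  then show "jones_wenzl N \<fatsemi> pad i (jones_wenzl n) j = jones_wenzl N"
    and "pad i (jones_wenzl n) j \<fatsemi> jones_wenzl N = jones_wenzl N"
    by simp_all
qed

lemma jones_wenzl_idem: "jones_wenzl n \<fatsemi> jones_wenzl n = jones_wenzl n"
  using jones_wenzl_absorb[of 0 n 0 n] by simp

text \<open>The defining recursion adds the new strand on the right; with this form a box can also
  be opened on the side facing its left neighbour.\<close>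

lemma jones_wenzl_Suc_mirror: "jones_wenzl (Suc n) = pad 1 (jones_wenzl n) 0
  - (qint (int n) / qint (int n + 1)) *\<^sub>K
    (pad 1 (jones_wenzl n) 0 \<fatsemi> pad 0 (cup \<fatsemi> cap) (n - 1) \<fatsemi> pad 1 (jones_wenzl n) 0)"
proof (cases n)
  case 0
  then show ?thesis
    by (simp add: pad_strands)
next
  case (Suc K)
  interpret tl_generators "strands (Suc n)" "\<lambda>t. pad t (cup \<fatsemi> cap) (Suc n - 2 - t)" n
    by (rule tl_generators_jones_wenzl)
  have *: "pad 1 (jones_wenzl n) 0 = jw_of (strands (Suc n)) (\<lambda>t. pad (Suc t) (cup \<fatsemi> cap) (Suc n - 2 - Suc t)) n"
    using pad_jones_wenzl[of 1 n 0 "Suc n"] by simp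
  show ?thesis
    unfolding * using jw_mirror[OF Suc] jones_wenzl_eq_jw_of[of "Suc n"] by (simp del: jw_of.simps)
qed

section \<open>Juxtaposition and pairs of boxes\<close>

lemma above_extend: "x \<fatsemi> y = z \<Longrightarrow> x \<fatsemi> y \<fatsemi> t = z \<fatsemi> t"
  by (simp flip: above_assoc)

text \<open>Juxtaposition lists the slices of the left factor first, so on diagrams this is a
  literal equality; the opposite order requires the exchange law.\<close>

lemma next_to_eq_above:
  assumes "x \<in> skein_module p q" "y \<in> skein_module r s"
  shows "x \<parallel> y = pad 0 x r \<fatsemi> pad q y 0"
  using assms(1)
proof (induction rule: skein_module_induct)
  case (basis t)
  from assms(2) show ?case
  proof (induction rule: skein_module_induct)
    case (basis u)
    note [simp] = \<open>upper t = p\<close> \<open>lower t = q\<close> \<open>upper u = r\<close> \<open>lower u = s\<close>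
    have "beside t u = stack (beside t (strands_tangle r)) (beside (strands_tangle q) u)"
      by (rule tangle_eqI) (simp_all add: upper_beside lower_beside upper_stack Rep_beside Rep_stack)
    then show ?case
      unfolding pad_def strands_0_next_to next_to_strands_0
      by (simp add: strands_def skein_of_next_to skein_of_above upper_beside lower_beside)
  qed (simp_all add: skein_linear pad_linear)
qed (simp_all add: skein_linear pad_linear)

lemma exchange_0:
  assumes "x \<in> skein_module p q" "y \<in> skein_module r s"
  shows "pad 0 x (r + j) \<fatsemi> pad q y j = pad p y j \<fatsemi> pad 0 x (s + j)"
  using exchange[OF assms, of 0 0] by simp

lemma next_to_eq_above':
  assumes "x \<in> skein_module p q" "y \<in> skein_module r s"
  shows "x \<parallel> y = pad p y 0 \<fatsemi> pad 0 x s"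
  using next_to_eq_above[OF assms] exchange_0[OF assms, of 0] by simp

lemma interchange:
  assumes x: "x \<in> skein_module p q" and x': "x' \<in> skein_module q r"
    and y: "y \<in> skein_module p' q'" and y': "y' \<in> skein_module q' r'"
  shows "(x \<parallel> y) \<fatsemi> (x' \<parallel> y') = (x \<fatsemi> x') \<parallel> (y \<fatsemi> y')"
proof -
  have "(x \<parallel> y) \<fatsemi> (x' \<parallel> y') = pad 0 x p' \<fatsemi> (pad q y 0 \<fatsemi> pad 0 x' q') \<fatsemi> pad r y' 0"
    by (simp add: next_to_eq_above[OF x y] next_to_eq_above[OF x' y'] above_assoc)
  also have "pad q y 0 \<fatsemi> pad 0 x' q' = pad 0 x' p' \<fatsemi> pad r y 0"
    using exchange_0[OF x' y, of 0] by simp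
  also have "pad 0 x p' \<fatsemi> (pad 0 x' p' \<fatsemi> pad r y 0) \<fatsemi> pad r y' 0
      = pad 0 (x \<fatsemi> x') p' \<fatsemi> pad r (y \<fatsemi> y') 0"
    by (simp add: pad_above above_assoc)
  also have "\<dots> = (x \<fatsemi> x') \<parallel> (y \<fatsemi> y')"
    by (rule next_to_eq_above[symmetric, OF skein_module_above[OF x x'] skein_module_above[OF y y']])
  finally show ?thesis .
qed

lemma skein_module_jones_wenzl_pair:
  "jones_wenzl a \<parallel> jones_wenzl b \<in> skein_module (a + b) (a + b)"
  by (intro skein_module_next_to skein_module_jones_wenzl)

lemma jones_wenzl_pair_idem:
  "(jones_wenzl a \<parallel> jones_wenzl b) \<fatsemi> (jones_wenzl a \<parallel> jones_wenzl b) = jones_wenzl a \<parallel> jones_wenzl b"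
  using interchange[OF skein_module_jones_wenzl[of a] skein_module_jones_wenzl[of a]
      skein_module_jones_wenzl[of b] skein_module_jones_wenzl[of b]]
  by (simp add: jones_wenzl_idem)

lemma jones_wenzl_pair_eq:
  "jones_wenzl a \<parallel> jones_wenzl b = pad 0 (jones_wenzl a) b \<fatsemi> pad a (jones_wenzl b) 0"
  "jones_wenzl a \<parallel> jones_wenzl b = pad a (jones_wenzl b) 0 \<fatsemi> pad 0 (jones_wenzl a) b"
  by (rule next_to_eq_above[OF skein_module_jones_wenzl skein_module_jones_wenzl])
    (rule next_to_eq_above'[OF skein_module_jones_wenzl skein_module_jones_wenzl])

text \<open>The small boxes slide down past the maximum along the vertical strands and are absorbed
  by the larger boxes.\<close>

lemma jones_wenzl_cap_absorb:
  "(jones_wenzl a \<parallel> jones_wenzl b) \<fatsemi> pad a cap b \<fatsemi> (jones_wenzl (Suc a) \<parallel> jones_wenzl (Suc b))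
    = pad a cap b \<fatsemi> (jones_wenzl (Suc a) \<parallel> jones_wenzl (Suc b))"
proof -
  note jw = skein_module_jones_wenzl
  have 1: "pad 0 (jones_wenzl a) b \<fatsemi> pad a cap b = pad a cap b \<fatsemi> pad 0 (jones_wenzl a) (Suc (Suc b))"
    using exchange_0[OF jw skein_module_cap, of a b] by simp
  have 2: "pad a (jones_wenzl b) 0 \<fatsemi> pad a cap b = pad a cap b \<fatsemi> pad (Suc (Suc a)) (jones_wenzl b) 0"
    using exchange[OF skein_module_cap jw, of a 0 b 0] by simp
  have 3: "pad 0 (jones_wenzl a) (Suc (Suc b)) \<fatsemi> (jones_wenzl (Suc a) \<parallel> jones_wenzl (Suc b))
      = jones_wenzl (Suc a) \<parallel> jones_wenzl (Suc b)"
    using pad_above[of 0 "pad 0 (jones_wenzl a) 1" "jones_wenzl (Suc a)" "Suc b"]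
    unfolding jones_wenzl_pair_eq(1)[of "Suc a"] by (simp add: pad_pad jones_wenzl_absorb flip: above_assoc)
  have 4: "pad (Suc (Suc a)) (jones_wenzl b) 0 \<fatsemi> (jones_wenzl (Suc a) \<parallel> jones_wenzl (Suc b))
      = jones_wenzl (Suc a) \<parallel> jones_wenzl (Suc b)"
    using pad_above[of "Suc a" "pad 1 (jones_wenzl b) 0" "jones_wenzl (Suc b)" 0]
    unfolding jones_wenzl_pair_eq(2)[of "Suc a"] by (simp add: pad_pad jones_wenzl_absorb flip: above_assoc)
  show ?thesis
    unfolding jones_wenzl_pair_eq(1)[of a] by (simp add: above_assoc 1[THEN above_extend] 2[THEN above_extend] 3 4)
qed

lemma jones_wenzl_cup_absorb:
  "(jones_wenzl (Suc a) \<parallel> jones_wenzl (Suc b)) \<fatsemi> pad a cup b \<fatsemi> (jones_wenzl a \<parallel> jones_wenzl b)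
    = (jones_wenzl (Suc a) \<parallel> jones_wenzl (Suc b)) \<fatsemi> pad a cup b"
proof -
  note jw = skein_module_jones_wenzl
  have 1: "pad a cup b \<fatsemi> pad 0 (jones_wenzl a) b = pad 0 (jones_wenzl a) (Suc (Suc b)) \<fatsemi> pad a cup b"
    using exchange_0[OF jw skein_module_cup, of a b] by simp
  have 2: "pad a cup b \<fatsemi> pad a (jones_wenzl b) 0 = pad (Suc (Suc a)) (jones_wenzl b) 0 \<fatsemi> pad a cup b"
    using exchange[OF skein_module_cup jw, of a 0 b 0] by simp
  have 3: "(jones_wenzl (Suc a) \<parallel> jones_wenzl (Suc b)) \<fatsemi> pad 0 (jones_wenzl a) (Suc (Suc b))
      = jones_wenzl (Suc a) \<parallel> jones_wenzl (Suc b)"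
    using pad_above[of 0 "jones_wenzl (Suc a)" "pad 0 (jones_wenzl a) 1" "Suc b"]
    unfolding jones_wenzl_pair_eq(2)[of "Suc a"] by (simp add: pad_pad jones_wenzl_absorb above_assoc)
  have 4: "(jones_wenzl (Suc a) \<parallel> jones_wenzl (Suc b)) \<fatsemi> pad (Suc (Suc a)) (jones_wenzl b) 0
      = jones_wenzl (Suc a) \<parallel> jones_wenzl (Suc b)"
    using pad_above[of "Suc a" "jones_wenzl (Suc b)" "pad 1 (jones_wenzl b) 0" 0]
    unfolding jones_wenzl_pair_eq(1)[of "Suc a"] by (simp add: pad_pad jones_wenzl_absorb above_assoc)
  show ?thesis
    unfolding jones_wenzl_pair_eq(1)[of a]
    by (simp add: 1[THEN above_extend] 2 3[THEN above_extend] 4[THEN above_extend] above_assoc)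
qed

text \<open>When the box is opened along its last strand, the leading term closes into a loop of
  value \<open>[2]\<close> and the other term straightens through two zigzags.\<close>

lemma jones_wenzl_partial_trace:
  "pad a cap 0 \<fatsemi> pad 0 (jones_wenzl (Suc a)) 1 \<fatsemi> pad a cup 0
    = (qint (int a + 2) / qint (int a + 1)) *\<^sub>K jones_wenzl a"
proof -
  note jw = skein_module_jones_wenzl
  define F where "F = pad 0 (jones_wenzl a) 2"
  define E where "E = pad (a - 1) (cup \<fatsemi> cap) 1"
  define c where "c = qint (int a) / qint (int a + 1)"
  have expand: "pad 0 (jones_wenzl (Suc a)) 1 = F - c *\<^sub>K (F \<fatsemi> E \<fatsemi> F)"
    unfolding jones_wenzl_Suc[of a]
    by (simp add: pad_linear pad_above pad_pad F_def E_def c_def numeral_2_eq_2)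
  have cap: "pad a cap 0 \<fatsemi> F = jones_wenzl a \<fatsemi> pad a cap 0"
    using exchange_0[OF jw skein_module_cap, of a 0] by (simp add: F_def)
  have cup: "F \<fatsemi> pad a cup 0 = pad a cup 0 \<fatsemi> jones_wenzl a"
    using exchange_0[OF jw skein_module_cup, of a 0] by (simp add: F_def)
  have loop: "pad a cap 0 \<fatsemi> F \<fatsemi> pad a cup 0 = qint 2 *\<^sub>K jones_wenzl a"
    using circle[of a 0] above_strands[OF jw, of a]
    by (simp add: cap[THEN above_extend] above_assoc skein_linear qint_2)
  have turnback: "c *\<^sub>K (pad a cap 0 \<fatsemi> F \<fatsemi> E \<fatsemi> F \<fatsemi> pad a cup 0) = c *\<^sub>K jones_wenzl a"
  proof (cases a)
    case (Suc a')
    have "pad (Suc a') cap 0 \<fatsemi> pad a' cup 1 \<fatsemi> pad a' cap 1 \<fatsemi> pad (Suc a') cup 0 \<fatsemi> jones_wenzl (Suc a')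
        = jones_wenzl (Suc a')"
      using zigzag_left_above[of "jones_wenzl (Suc a')" a' 0] jw[of "Suc a'"]
        zigzag_right_above[of "jones_wenzl (Suc a')" a' 0] by simp
    moreover have "pad a cap 0 \<fatsemi> F \<fatsemi> E \<fatsemi> F \<fatsemi> pad a cup 0
        = jones_wenzl a \<fatsemi> pad a cap 0 \<fatsemi> E \<fatsemi> pad a cup 0 \<fatsemi> jones_wenzl a"
      by (simp add: cap[THEN above_extend] cup above_assoc)
    ultimately show ?thesis
      by (simp add: above_assoc E_def pad_above Suc jones_wenzl_idem del: jones_wenzl.simps)
  qed (simp add: c_def)
  have "pad a cap 0 \<fatsemi> pad 0 (jones_wenzl (Suc a)) 1 \<fatsemi> pad a cup 0
      = pad a cap 0 \<fatsemi> F \<fatsemi> pad a cup 0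
        - c *\<^sub>K (pad a cap 0 \<fatsemi> F \<fatsemi> E \<fatsemi> F \<fatsemi> pad a cup 0)"
    unfolding expand by (simp add: skein_linear above_assoc)
  also have "\<dots> = (qint 2 - c) *\<^sub>K jones_wenzl a"
    by (simp only: loop turnback skein.scale_left_diff_distrib)
  also have "qint 2 - c = qint (int a + 2) / qint (int a + 1)"
    using qint_Suc_div[of "int a + 1"] by (simp add: c_def add.commute)
  finally show ?thesis .
qed

text \<open>The right box is expanded along its leftmost strand, which is the one next to the left box.
  The leading term closes up one strand of the left box; in the other term the left box is dragged,
  along a zigzag, between two copies of the smaller right box, where it is expanded in turn.\<close>

lemma cap_pair_cup:
  "pad a cap b \<fatsemi> (jones_wenzl (Suc a) \<parallel> jones_wenzl (Suc b)) \<fatsemi> pad a cup b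
    = (qint (int a + 2) / qint (int a + 1) - qint (int b) / qint (int b + 1)) *\<^sub>K
        (jones_wenzl a \<parallel> jones_wenzl b)
      + (qint (int a) * qint (int b) / (qint (int a + 1) * qint (int b + 1))) *\<^sub>K
        ((jones_wenzl a \<parallel> jones_wenzl b) \<fatsemi> pad (a - 1) (cup \<fatsemi> cap) (b - 1)
          \<fatsemi> (jones_wenzl a \<parallel> jones_wenzl b))"
proof -
  note jw = skein_module_jones_wenzl
  define K U where "K = pad a cap b" and "U = pad a cup b"
  define L where "L = pad 0 (jones_wenzl (Suc a)) (Suc b)"
  define R where "R = pad (Suc (Suc a)) (jones_wenzl b) 0"
  define E where "E = pad (Suc a) (cup \<fatsemi> cap) (b - 1)"
  define X where "X = pad (a - 1) (cup \<fatsemi> cap) (b - 1)"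
  define P Q where "P = pad 0 (jones_wenzl a) b" and "Q = pad a (jones_wenzl b) 0"
  define G where "G = jones_wenzl a \<parallel> jones_wenzl b"
  define r c c' where "r = qint (int a + 2) / qint (int a + 1)"
    and "c = qint (int b) / qint (int b + 1)" and "c' = qint (int a) / qint (int a + 1)"
  have PQ: "P \<fatsemi> Q = G" and QP: "Q \<fatsemi> P = G"
    by (simp_all add: G_def P_def Q_def jones_wenzl_pair_eq[symmetric])
  have QQ: "Q \<fatsemi> Q = Q"
    by (simp add: Q_def jones_wenzl_idem flip: pad_above)
  have "pad (Suc a) (jones_wenzl (Suc b)) 0 = R - c *\<^sub>K (R \<fatsemi> E \<fatsemi> R)"
    unfolding jones_wenzl_Suc_mirror[of b]
    by (simp add: pad_linear pad_above pad_pad R_def E_def c_def)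
  then have expand: "jones_wenzl (Suc a) \<parallel> jones_wenzl (Suc b) = L \<fatsemi> R - c *\<^sub>K (L \<fatsemi> R \<fatsemi> E \<fatsemi> R)"
    by (simp add: jones_wenzl_pair_eq(1)[of "Suc a"] skein_linear L_def)
  have RU: "R \<fatsemi> U = U \<fatsemi> Q"
    using exchange[OF skein_module_cup jw, of a 0 b 0] by (simp add: R_def U_def Q_def)
  have KR: "K \<fatsemi> R = Q \<fatsemi> K"
    using exchange[OF skein_module_cap jw, of a 0 b 0] by (simp add: R_def K_def Q_def)
  have LR: "L \<fatsemi> R = R \<fatsemi> L"
    using exchange[OF jw jw, of 0 "Suc a" 1 b 0] by (simp add: R_def L_def)
  \<comment> \<open>The maximum and the minimum close up the last strand of the left box.\<close>
  have KLU: "K \<fatsemi> L \<fatsemi> U = r *\<^sub>K P"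
    using arg_cong[OF jones_wenzl_partial_trace[of a], of "\<lambda>x. pad 0 x b"]
    by (simp add: pad_linear pad_above pad_pad K_def L_def U_def P_def r_def)
  have first: "K \<fatsemi> L \<fatsemi> R \<fatsemi> U = r *\<^sub>K G"
    using KLU by (simp add: RU skein_linear flip: above_assoc PQ)
  have second: "c *\<^sub>K (K \<fatsemi> L \<fatsemi> R \<fatsemi> E \<fatsemi> R \<fatsemi> U) = c *\<^sub>K (G - c' *\<^sub>K (G \<fatsemi> X \<fatsemi> G))"
  proof (cases b)
    case (Suc b')
    \<comment> \<open>The position to which the zigzags drag the left box: its last strand is now
      the first strand of the smaller right box.\<close>
    define L' where "L' = pad 0 (jones_wenzl (Suc a)) b'"
    have L': "L' \<in> skein_module (a + b' + 1) (a + b' + 1)"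
      unfolding L'_def by (rule skein_module_pad[OF jw]) auto
    have Q: "Q \<in> skein_module (a + b' + 1) (a + b' + 1)"
      unfolding Q_def by (rule skein_module_pad[OF jw]) (auto simp: Suc)
    have "L' = pad 0 (jones_wenzl a) (Suc b') - c' *\<^sub>K (pad 0 (jones_wenzl a) (Suc b')
        \<fatsemi> pad (a - 1) (cup \<fatsemi> cap) b' \<fatsemi> pad 0 (jones_wenzl a) (Suc b'))"
      unfolding jones_wenzl_Suc[of a] L'_def
      by (simp add: pad_linear pad_above pad_pad c'_def)
    then have L'_expand: "L' = P - c' *\<^sub>K (P \<fatsemi> X \<fatsemi> P)"
      by (simp add: P_def X_def Suc)
    have slide: "L \<fatsemi> pad (Suc a) cup b' = pad (Suc a) cup b' \<fatsemi> L'"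
      using exchange_0[OF jw skein_module_cup, of "Suc a" b']
      by (simp add: L_def L'_def Suc del: jones_wenzl.simps)
    \<comment> \<open>The maximum of \<open>E\<close> cancels with the minimum \<open>U\<close>; the
      minimum of \<open>E\<close> slides up past \<open>L\<close> and cancels with the maximum
      \<open>K\<close>.\<close>
    have "K \<fatsemi> L \<fatsemi> E \<fatsemi> U \<fatsemi> Q = K \<fatsemi> L \<fatsemi> pad (Suc a) cup b' \<fatsemi> Q"
      using zigzag_right_above[OF Q]
      by (simp add: E_def U_def Suc pad_above above_assoc)
    also have "\<dots> = L' \<fatsemi> Q"
      using zigzag_left_above[OF skein_module_above[OF L' Q]]
      by (simp add: slide[THEN above_extend] above_assoc K_def Suc)
    finally have middle: "K \<fatsemi> L \<fatsemi> E \<fatsemi> U \<fatsemi> Q = L' \<fatsemi> Q" .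
    have "K \<fatsemi> L \<fatsemi> R \<fatsemi> E \<fatsemi> R \<fatsemi> U = Q \<fatsemi> K \<fatsemi> L \<fatsemi> E \<fatsemi> U \<fatsemi> Q"
      by (simp add: LR[THEN above_extend] KR[THEN above_extend] RU above_assoc)
    also have "\<dots> = Q \<fatsemi> L' \<fatsemi> Q"
      by (simp add: middle)
    also have "\<dots> = G - c' *\<^sub>K (G \<fatsemi> X \<fatsemi> G)"
      using PQ QP QQ QP[THEN above_extend]
      by (simp add: L'_expand skein_linear above_assoc) (metis above_assoc)
    finally show ?thesis
      by simp
  qed (simp add: c_def)
  have "K \<fatsemi> (jones_wenzl (Suc a) \<parallel> jones_wenzl (Suc b)) \<fatsemi> U
      = (r - c) *\<^sub>K G + (c' * c) *\<^sub>K (G \<fatsemi> X \<fatsemi> G)"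
    using first second
    by (simp add: expand skein_linear above_assoc skein.scale_left_diff_distrib
        skein.scale_right_diff_distrib mult.commute)
  then show ?thesis
    by (simp add: K_def U_def G_def X_def r_def c_def c'_def)
qed


section \<open>Recursion for the bubble skein element\<close>

lemma caps_in: "caps k \<in> skein_module 0 (2 * k)"
proof (induction k)
  case (Suc k)
  have "pad 1 (caps k) 1 \<in> skein_module 2 (2 * Suc k)"
    by (rule skein_module_pad[OF Suc]) auto
  then show ?case
    using skein_module_above[OF skein_module_cap] by (simp add: pad_def)
qed (simp add: strands_in_skein_module)

lemma cups_in: "cups k \<in> skein_module (2 * k) 0"
proof (induction k)
  case (Suc k)
  have "pad 1 (cups k) 1 \<in> skein_module (2 * Suc k) 2"
    by (rule skein_module_pad[OF Suc]) auto
  then show ?case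
    using skein_module_above[OF _ skein_module_cup] by (simp add: pad_def)
qed (simp add: strands_in_skein_module)

lemma pad_caps_Suc_outer: "pad i (caps (Suc k)) j = pad i cap j \<fatsemi> pad (Suc i) (caps k) (Suc j)"
  by (simp add: pad_above pad_pad flip: pad_def)

lemma pad_cups_Suc_outer: "pad i (cups (Suc k)) j = pad (Suc i) (cups k) (Suc j) \<fatsemi> pad i cup j"
  by (simp add: pad_above pad_pad flip: pad_def)

text \<open>The definition of \<open>caps\<close> adds the outermost arc. The recursion needs the
  innermost one, which joins the facing strands of the two boxes.\<close>

lemma pad_caps_Suc: "pad i (caps (Suc k)) j = pad i (caps k) j \<fatsemi> pad (i + k) cap (j + k)"
proof (induction k arbitrary: i j)
  case 0
  then show ?case
    using strands_above[OF pad_cap_in[of i j]] by (simp add: pad_strands caps_1[simplified])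
next
  case (Suc k)
  show ?case
    unfolding pad_caps_Suc_outer[of i "Suc k" j] Suc[of "Suc i" "Suc j"]
    by (simp add: pad_caps_Suc_outer above_assoc del: caps.simps)
qed

lemma pad_cups_Suc: "pad i (cups (Suc k)) j = pad (i + k) cup (j + k) \<fatsemi> pad i (cups k) j"
proof (induction k arbitrary: i j)
  case 0
  then show ?case
    using above_strands[OF pad_cup_in[of i j]] by (simp add: pad_strands cups_1[simplified])
next
  case (Suc k)
  show ?case
    unfolding pad_cups_Suc_outer[of i "Suc k" j] Suc[of "Suc i" "Suc j"]
    by (simp add: pad_cups_Suc_outer above_assoc del: cups.simps)
qed

text \<open>The bubble down to the lower sides of its two boxes; lower arcs are attached by
  stacking.\<close>

definition bubble_top :: "nat \<Rightarrow> nat \<Rightarrow> nat \<Rightarrow> skein"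
  where "bubble_top m n k = (jones_wenzl m \<parallel> jones_wenzl n) \<fatsemi> pad m (caps k) n
    \<fatsemi> (jones_wenzl (m + k) \<parallel> jones_wenzl (n + k))"

text \<open>For positive m and n, one strand of each upper cluster returns to the top through a
  minimum, and k + 1 arcs enter the boxes. The box sizes are unchanged because m + k = (m - 1) + (k
  + 1).\<close>

definition turnback :: "nat \<Rightarrow> nat \<Rightarrow> nat \<Rightarrow> skein"
  where "turnback m n k = (jones_wenzl m \<parallel> jones_wenzl n) \<fatsemi> pad (m - 1) cup (n - 1)
    \<fatsemi> pad (m - 1) (caps (Suc k)) (n - 1) \<fatsemi> (jones_wenzl (m + k) \<parallel> jones_wenzl (n + k))"

text \<open>Boxes of sizes m + k and n + k may be inserted between the innermost arc and the other
  arcs, since the larger boxes absorb them.\<close>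

lemma bubble_top_Suc: "bubble_top m n (Suc k)
  = bubble_top m n k \<fatsemi> pad (m + k) cap (n + k) \<fatsemi> (jones_wenzl (Suc (m + k)) \<parallel> jones_wenzl (Suc (n + k)))"
  by (simp add: bubble_top_def pad_caps_Suc above_assoc jones_wenzl_cap_absorb
      del: jones_wenzl.simps caps.simps)

lemma turnback_Suc:
  assumes "m > 0" "n > 0"
  shows "turnback m n (Suc k)
    = turnback m n k \<fatsemi> pad (m + k) cap (n + k) \<fatsemi> (jones_wenzl (Suc (m + k)) \<parallel> jones_wenzl (Suc (n + k)))"
proof -
  have "m - 1 + Suc k = m + k" "n - 1 + Suc k = n + k"
    using assms by simp_all
  then show ?thesis
    by (simp add: turnback_def pad_caps_Suc[of _ "Suc k"] above_assoc jones_wenzl_cap_absorb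
        del: jones_wenzl.simps caps.simps add_Suc_right) simp
qed

lemma bubble_top_cup:
  "bubble_top m n (Suc k) \<fatsemi> pad (m + k) cup (n + k)
    = (qint (int k + 1) * qint (int m + int n + int k + 2)
        / (qint (int m + int k + 1) * qint (int n + int k + 1))) *\<^sub>K bubble_top m n k
      + (qint (int m) * qint (int n)
        / (qint (int m + int k + 1) * qint (int n + int k + 1))) *\<^sub>K turnback m n k"
proof -
  define J where "J k = jones_wenzl (m + k) \<parallel> jones_wenzl (n + k)" for k
  define D where "D k = qint (int m + int k) * qint (int n + int k)" for k
  have D_Suc: "D (Suc k) = qint (int m + int k + 1) * qint (int n + int k + 1)" for k
    by (simp add: D_def add_ac)
  have nz: "qint (int m + int k + 1) \<noteq> 0" "qint (int n + int k + 1) \<noteq> 0" for k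
    by (simp_all add: qint_neq_0)
  have step: "bubble_top m n (Suc k) \<fatsemi> pad (m + k) cup (n + k)
      = (qint (int m + int n + 2 * int k + 2) / D (Suc k)) *\<^sub>K bubble_top m n k
        + (D k / D (Suc k)) *\<^sub>K (bubble_top m n k \<fatsemi> pad (m + k - 1) (cup \<fatsemi> cap) (n + k - 1) \<fatsemi> J k)" for k
  proof -
    have absorb: "bubble_top m n k \<fatsemi> J k = bubble_top m n k"
      by (simp add: bubble_top_def J_def above_assoc jones_wenzl_pair_idem)
    have "bubble_top m n (Suc k) \<fatsemi> pad (m + k) cup (n + k)
        = bubble_top m n k \<fatsemi> (pad (m + k) cap (n + k)
          \<fatsemi> (jones_wenzl (Suc (m + k)) \<parallel> jones_wenzl (Suc (n + k))) \<fatsemi> pad (m + k) cup (n + k))"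
      by (simp add: bubble_top_Suc above_assoc del: jones_wenzl.simps)
    also have "\<dots> = (qint (int (m + k) + 2) / qint (int (m + k) + 1) - qint (int (n + k)) / qint (int (n + k) + 1))
          *\<^sub>K bubble_top m n k
        + (D k / D (Suc k)) *\<^sub>K (bubble_top m n k \<fatsemi> pad (m + k - 1) (cup \<fatsemi> cap) (n + k - 1) \<fatsemi> J k)"
      unfolding cap_pair_cup
      by (simp add: above_add_right above_scale_right absorb absorb[THEN above_extend] D_Suc
          flip: J_def) (simp add: D_def)
    \<comment> \<open>With a = m + k and b = n + k this is
      \<open>[a + 2] [b + 1] - [a + 1] [b] = [a + b + 2]\<close>.\<close>
    also have "qint (int (m + k) + 2) / qint (int (m + k) + 1) - qint (int (n + k)) / qint (int (n + k) + 1)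
        = qint (int m + int n + 2 * int k + 2) / D (Suc k)"
      using qint_mult[of "int m + int k + 2" "int m + int n + 2 * int k + 2" "int m + int k + 1"] nz[of k]
      by (simp add: D_Suc diff_frac_eq algebra_simps)
    finally show ?thesis .
  qed
  show ?thesis
  proof (induction k)
    case 0
    have "bubble_top m n 0 = J 0"
      using strands_above[OF skein_module_jones_wenzl_pair[of m n]]
      by (simp add: bubble_top_def pad_strands jones_wenzl_pair_idem J_def)
    then have "D 0 *\<^sub>K (bubble_top m n 0 \<fatsemi> pad (m + 0 - 1) (cup \<fatsemi> cap) (n + 0 - 1) \<fatsemi> J 0)
        = D 0 *\<^sub>K turnback m n 0"
      by (simp add: turnback_def J_def caps_1[simplified] pad_above above_assoc)
    from arg_cong[OF this, of "\<lambda>x. (1 / D (Suc 0)) *\<^sub>K x"]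
    have "(D 0 / D (Suc 0)) *\<^sub>K (bubble_top m n 0 \<fatsemi> pad (m + 0 - 1) (cup \<fatsemi> cap) (n + 0 - 1) \<fatsemi> J 0)
        = (D 0 / D (Suc 0)) *\<^sub>K turnback m n 0"
      by (simp only: skein.scale_scale times_divide_eq_left mult_1)
    with step[of 0] show ?case
      by (simp only:) (simp add: D_def add_ac)
  next
    case (Suc k)
    define B where "B = qint (int m) * qint (int n)"
    define C where "C = qint (int k + 1) * qint (int m + int n + int k + 2)"
    have IH: "bubble_top m n (Suc k) \<fatsemi> pad (m + k) cup (n + k)
        = (C / D (Suc k)) *\<^sub>K bubble_top m n k + (B / D (Suc k)) *\<^sub>K turnback m n k"
      unfolding B_def C_def D_Suc by (rule Suc)
    \<comment> \<open>For m = 0 or n = 0 the turn-back is degenerate, but then \<open>B\<close>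
      contains \<open>[0]\<close>.\<close>
    have next_turnback: "(c * B) *\<^sub>K (turnback m n k \<fatsemi> pad (m + k) cap (n + k) \<fatsemi> J (Suc k))
        = (c * B) *\<^sub>K turnback m n (Suc k)" for c
    proof (cases "m > 0 \<and> n > 0")
      case True
      then show ?thesis
        by (simp add: turnback_Suc J_def del: jones_wenzl.simps)
    qed (auto simp: B_def)
    \<comment> \<open>The minimum closes the bubble of the previous stage, so the induction
      hypothesis applies; the maximum and the boxes below it then extend both resulting terms by one
      arc.\<close>
    have "bubble_top m n (Suc k) \<fatsemi> pad (m + k) (cup \<fatsemi> cap) (n + k) \<fatsemi> J (Suc k)
        = (bubble_top m n (Suc k) \<fatsemi> pad (m + k) cup (n + k)) \<fatsemi> pad (m + k) cap (n + k) \<fatsemi> J (Suc k)"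
      by (simp add: pad_above above_assoc)
    also have "\<dots> = (C / D (Suc k)) *\<^sub>K bubble_top m n (Suc k)
        + (B / D (Suc k)) *\<^sub>K (turnback m n k \<fatsemi> pad (m + k) cap (n + k) \<fatsemi> J (Suc k))"
      unfolding IH
      by (simp add: above_add_left above_scale_left above_assoc bubble_top_Suc J_def del: jones_wenzl.simps)
    also have "\<dots> = (C / D (Suc k)) *\<^sub>K bubble_top m n (Suc k) + (B / D (Suc k)) *\<^sub>K turnback m n (Suc k)"
      using next_turnback[of "1 / D (Suc k)"] by simp
    finally have eq: "bubble_top m n (Suc k) \<fatsemi> pad (m + k) (cup \<fatsemi> cap) (n + k) \<fatsemi> J (Suc k) = \<dots>" .
    have "D (Suc k) \<noteq> 0"
      using nz by (simp add: D_Suc)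
    then have "bubble_top m n (Suc (Suc k)) \<fatsemi> pad (m + Suc k) cup (n + Suc k)
        = ((qint (int m + int n + 2 * int (Suc k) + 2) + C) / D (Suc (Suc k))) *\<^sub>K bubble_top m n (Suc k)
          + (B / D (Suc (Suc k))) *\<^sub>K turnback m n (Suc k)"
      using step[of "Suc k"] eq
      by (simp add: skein.scale_right_distrib skein.scale_left_distrib add_divide_distrib)
    \<comment> \<open>One step of the telescoping sum: adding \<open>[m + n + 2 k + 4]\<close> to
      \<open>[k + 1] [m + n + k + 2]\<close> gives the next product.\<close>
    also have "qint (int m + int n + 2 * int (Suc k) + 2) + C
        = qint (int (Suc k) + 1) * qint (int m + int n + int (Suc k) + 2)"
      using qint_mult[of "int k + 2" "int m + int n + 2 * int k + 4" "int k + 1"]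
      by (simp add: C_def algebra_simps)
    finally show ?case
      unfolding B_def D_Suc .
  qed
qed

section \<open>Assembling the expansion\<close>

lemma bubble_eq: "bubble m n m' n' k l
  = bubble_top m n k \<fatsemi> pad m' (cups l) n' \<fatsemi> (jones_wenzl m' \<parallel> jones_wenzl n')"
  by (simp add: bubble_def place_idempotents_def bubble_top_def pad_def above_assoc)

lemma arcs_element_eq: "arcs_element m n m' n' a b
  = (jones_wenzl m \<parallel> jones_wenzl n) \<fatsemi> pad (m - a) (cups a) (n - a)
    \<fatsemi> pad (m' - b) (caps b) (n' - b) \<fatsemi> (jones_wenzl m' \<parallel> jones_wenzl n')"
  by (simp add: arcs_element_def place_idempotents_def pad_def above_assoc)

text \<open>Below the split-off minimum there is the upper half of a bubble whose upper clusters are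
  smaller by one. Its boundary boxes can be supplied because the larger ones above the minimum
  absorb them.\<close>

lemma turnback_bubble: "turnback (Suc m) (Suc n) k \<fatsemi> pad m' (cups l) n' \<fatsemi> (jones_wenzl m' \<parallel> jones_wenzl n')
  = (jones_wenzl (Suc m) \<parallel> jones_wenzl (Suc n)) \<fatsemi> pad m cup n \<fatsemi> bubble m n m' n' (Suc k) l"
  using jones_wenzl_cup_absorb[of m n, THEN above_extend]
  by (simp add: turnback_def bubble_eq bubble_top_def above_assoc del: jones_wenzl.simps caps.simps)

text \<open>The split-off arc becomes the innermost of the arcs between the upper clusters.\<close>

lemma cup_arcs_element:
  assumes "i \<le> m" "i \<le> n"
  shows "(jones_wenzl (Suc m) \<parallel> jones_wenzl (Suc n)) \<fatsemi> pad m cup n \<fatsemi> arcs_element m n m' n' i b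
    = arcs_element (Suc m) (Suc n) m' n' (Suc i) b"
  using jones_wenzl_cup_absorb[of m n, THEN above_extend] assms
    pad_cups_Suc[of "m - i" i "n - i"]
  by (simp add: arcs_element_eq above_assoc del: jones_wenzl.simps cups.simps)

lemma bubble_coeff_eq_0:
  assumes "i \<le> l" "m < i \<or> n < i"
  shows "bubble_coeff m n k l i = 0"
  using assms by (auto simp: bubble_coeff_eq symmetric_coeff_def falling_qfact_eq_0)

text \<open>The recursion of \<open>symmetric_coeff\<close> carried over to natural numbers:
  wherever m - 1 or n - 1 is truncated, the factor \<open>[m] [n]\<close> is 0.\<close>

lemma bubble_coeff_Suc:
  fixes m n k :: nat
  defines "w \<equiv> qint (int m + int k + 1) * qint (int n + int k + 1)"
  assumes "i \<le> Suc l"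
  shows "bubble_coeff m n (Suc k) (Suc l) i
    = (if i \<le> l then qint (int k + 1) * qint (int m + int n + int k + 2) / w * bubble_coeff m n k l i else 0)
    + (if i = 0 then 0 else qint (int m) * qint (int n) / w * bubble_coeff (m - 1) (n - 1) (Suc k) l (i - 1))"
proof -
  have shift: "qint (int m) * qint (int n) / w * bubble_coeff (m - 1) (n - 1) (Suc k) l (i - 1)
      = qint (int m) * qint (int n) / w
        * symmetric_coeff (int m - 1) (int n - 1) (int k + 1) (i - 1) (Suc l - i)" if "i \<noteq> 0"
  proof (cases "m = 0 \<or> n = 0")
    case False
    then have "int (m - 1) = int m - 1" "int (n - 1) = int n - 1"
      by simp_all
    moreover have "l - (i - 1) = Suc l - i" "int (Suc k) = int k + 1" "i - 1 \<le> l"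
      using that assms(2) by simp_all
    ultimately show ?thesis
      by (simp only: bubble_coeff_eq)
  qed auto
  have "bubble_coeff m n (Suc k) (Suc l) i
      = symmetric_coeff (int m) (int n) (int k + 1) i (Suc l - i)"
    using bubble_coeff_eq[OF assms(2)] by (simp add: add.commute)
  also have "\<dots> = (if Suc l - i = 0 then 0 else qint (int k + 1) * qint (int m + int n + int k + 2) / w
        * symmetric_coeff (int m) (int n) (int k) i (Suc l - i - 1))
      + (if i = 0 then 0 else qint (int m) * qint (int n) / w
        * symmetric_coeff (int m - 1) (int n - 1) (int k + 1) (i - 1) (Suc l - i))"
    unfolding w_def by (rule symmetric_coeff_rec) (use assms(2) in simp)
  also have "(if Suc l - i = 0 then 0 else qint (int k + 1) * qint (int m + int n + int k + 2) / w
        * symmetric_coeff (int m) (int n) (int k) i (Suc l - i - 1))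
      = (if i \<le> l then qint (int k + 1) * qint (int m + int n + int k + 2) / w * bubble_coeff m n k l i else 0)"
    using bubble_coeff_eq[of i l m n k] assms(2) by simp
  also have "(if i = 0 then 0 else qint (int m) * qint (int n) / w
        * symmetric_coeff (int m - 1) (int n - 1) (int k + 1) (i - 1) (Suc l - i))
      = (if i = 0 then 0 else qint (int m) * qint (int n) / w * bubble_coeff (m - 1) (n - 1) (Suc k) l (i - 1))"
    by (rule if_cong, rule refl, rule refl) (rule shift[symmetric])
  finally show ?thesis .
qed

text \<open>Summation up to l keeps the index set independent of m and n, so the two sums of the
  induction step can be aligned. The lower clusters stay fixed while m, n and k vary.\<close>

lemma bubble_expansion:
  assumes "l \<le> k" "m + k = m' + l" "n + k = n' + l"
  shows "bubble m n m' n' k l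
    = (\<Sum>i\<le>l. bubble_coeff m n k l i *\<^sub>K arcs_element m n m' n' i (k - l + i))"
  using assms
proof (induction l arbitrary: m n k)
  case 0
  have "strands (m + n) \<fatsemi> pad m (caps k) n = pad m (caps k) n"
    by (rule strands_above[OF skein_module_pad[OF caps_in]]) simp_all
  from this[THEN above_extend] have "bubble m n m' n' k 0 = arcs_element m n m' n' 0 k"
    using 0 strands_above[OF skein_module_jones_wenzl_pair[of m' n']]
    by (auto simp: bubble_eq bubble_top_def arcs_element_eq pad_strands above_assoc jones_wenzl_pair_idem)
  moreover have "bubble_coeff m n k 0 0 = 1"
    by (simp add: bubble_coeff_eq symmetric_coeff_def)
  ultimately show ?case
    by simp
next
  case (Suc l)
  then obtain k' where k: "k = Suc k'"
    by (cases k) auto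
  define w where "w = qint (int m + int k' + 1) * qint (int n + int k' + 1)"
  define \<gamma> where "\<gamma> = qint (int k' + 1) * qint (int m + int n + int k' + 2) / w"
  define \<epsilon> where "\<epsilon> = qint (int m) * qint (int n) / w"
  define V where "V = pad m' (cups l) n' \<fatsemi> (jones_wenzl m' \<parallel> jones_wenzl n')"
  define A where "A i = arcs_element m n m' n' i (k' - l + i)" for i
  have "bubble m n m' n' k (Suc l) = (bubble_top m n (Suc k') \<fatsemi> pad (m + k') cup (n + k')) \<fatsemi> V"
    using Suc.prems by (simp add: bubble_eq k V_def pad_cups_Suc above_assoc del: cups.simps)
  also have "\<dots> = \<gamma> *\<^sub>K bubble m n m' n' k' l + \<epsilon> *\<^sub>K (turnback m n k' \<fatsemi> V)"
    unfolding bubble_top_cup \<gamma>_def \<epsilon>_def w_def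
    by (simp add: above_add_left above_scale_left bubble_eq V_def above_assoc)
  also have "bubble m n m' n' k' l = (\<Sum>i\<le>l. bubble_coeff m n k' l i *\<^sub>K A i)"
    unfolding A_def using Suc.prems by (intro Suc.IH) (auto simp: k)
  also have "\<epsilon> *\<^sub>K (turnback m n k' \<fatsemi> V)
      = \<epsilon> *\<^sub>K (\<Sum>i\<le>l. bubble_coeff (m - 1) (n - 1) k l i *\<^sub>K A (Suc i))"
  proof (cases "m = 0 \<or> n = 0")
    case False
    then obtain m1 n1 where mn: "m = Suc m1" "n = Suc n1"
      by (metis not0_implies_Suc)
    let ?J = "jones_wenzl m \<parallel> jones_wenzl n"
    have "turnback m n k' \<fatsemi> V = ?J \<fatsemi> pad m1 cup n1 \<fatsemi> bubble m1 n1 m' n' k l"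
      unfolding V_def mn k by (rule turnback_bubble)
    also have "bubble m1 n1 m' n' k l
        = (\<Sum>i\<le>l. bubble_coeff m1 n1 k l i *\<^sub>K arcs_element m1 n1 m' n' i (k - l + i))"
      using Suc.prems by (intro Suc.IH) (auto simp: mn)
    also have "?J \<fatsemi> pad m1 cup n1 \<fatsemi> \<dots>
        = (\<Sum>i\<le>l. bubble_coeff m1 n1 k l i *\<^sub>K (?J \<fatsemi> pad m1 cup n1 \<fatsemi> arcs_element m1 n1 m' n' i (k - l + i)))"
      by (simp only: above_sum_right above_scale_right)
    also have "\<dots> = (\<Sum>i\<le>l. bubble_coeff m1 n1 k l i *\<^sub>K A (Suc i))"
    proof (rule sum.cong[OF refl])
      fix i assume "i \<in> {..l}"
      show "bubble_coeff m1 n1 k l i *\<^sub>K (?J \<fatsemi> pad m1 cup n1 \<fatsemi> arcs_element m1 n1 m' n' i (k - l + i))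
          = bubble_coeff m1 n1 k l i *\<^sub>K A (Suc i)"
      proof (cases "i \<le> m1 \<and> i \<le> n1")
        case True
        \<comment> \<open>One more upper arc goes with one more lower arc than in the first sum, so
          both sums run over the same elements \<open>A\<close>; this uses
          \<open>l \<le> k'\<close>.\<close>
        have "k - l + i = k' - l + Suc i"
          using Suc.prems(1) by (simp add: k)
        then show ?thesis
          unfolding A_def mn using True by (simp only: cup_arcs_element)
      next
        case False
        \<comment> \<open>There are too few strands for i arcs here, and the coefficient is
          0.\<close>
        then show ?thesis
          using bubble_coeff_eq_0[of i l m1 n1 k] \<open>i \<in> {..l}\<close> by auto
      qed
    qed
    finally show ?thesis
      by (simp add: mn)
  qed (auto simp: \<epsilon>_def)
  \<comment> \<open>Both sums are extended by a zero term to the range up to l + 1: the first at its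
    upper end, the shifted one at 0.\<close>
  also have "\<gamma> *\<^sub>K (\<Sum>i\<le>l. bubble_coeff m n k' l i *\<^sub>K A i)
      + \<epsilon> *\<^sub>K (\<Sum>i\<le>l. bubble_coeff (m - 1) (n - 1) k l i *\<^sub>K A (Suc i))
      = (\<Sum>i\<le>Suc l. (if i \<le> l then \<gamma> * bubble_coeff m n k' l i else 0) *\<^sub>K A i)
      + (\<Sum>i\<le>Suc l. (if i = 0 then 0 else \<epsilon> * bubble_coeff (m - 1) (n - 1) k l (i - 1)) *\<^sub>K A i)"
  proof -
    have "(\<Sum>i\<le>Suc l. (if i \<le> l then \<gamma> * bubble_coeff m n k' l i else 0) *\<^sub>K A i)
        = \<gamma> *\<^sub>K (\<Sum>i\<le>l. bubble_coeff m n k' l i *\<^sub>K A i)"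
      by (simp add: skein.scale_sum_right)
    moreover have "(\<Sum>i\<le>Suc l. (if i = 0 then 0 else \<epsilon> * bubble_coeff (m - 1) (n - 1) k l (i - 1)) *\<^sub>K A i)
        = \<epsilon> *\<^sub>K (\<Sum>i\<le>l. bubble_coeff (m - 1) (n - 1) k l i *\<^sub>K A (Suc i))"
      by (simp add: skein.scale_sum_right sum.atMost_Suc_shift del: sum.atMost_Suc)
    ultimately show ?thesis
      by simp
  qed
  also have "\<dots> = (\<Sum>i\<le>Suc l. bubble_coeff m n k (Suc l) i *\<^sub>K A i)"
    unfolding sum.distrib[symmetric] skein.scale_left_distrib[symmetric]
    by (rule sum.cong[OF refl]) (simp add: k bubble_coeff_Suc \<gamma>_def \<epsilon>_def w_def)
  finally show ?case
    by (simp add: A_def k)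
qed

section \<open>Membership in the module and the final statement\<close>

lemma bubble_in_clustered_module:
  assumes "m + k = m' + l" "n + k = n' + l"
  shows "bubble m n m' n' k l \<in> clustered_module m n m' n'"
proof -
  have "pad m (caps k) n \<in> skein_module (m + n) (m + k + (n + k))"
    "pad m' (cups l) n' \<in> skein_module (m + k + (n + k)) (m' + n')"
    by (rule skein_module_pad[OF caps_in]; simp)
      (rule skein_module_pad[OF cups_in]; use assms in simp)
  then show ?thesis
    unfolding bubble_def clustered_module_def
    by (intro imageI) (auto simp: pad_def intro!: skein_module_above skein_module_jones_wenzl_pair)
qed

lemma arcs_element_in_clustered_module:
  assumes "a \<le> m" "a \<le> n" "b \<le> m'" "b \<le> n'" "m - a = m' - b" "n - a = n' - b"
  shows "arcs_element m n m' n' a b \<in> clustered_module m n m' n'"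
proof -
  have "pad (m - a) (cups a) (n - a) \<in> skein_module (m + n) (m - a + (n - a))"
    "pad (m' - b) (caps b) (n' - b) \<in> skein_module (m - a + (n - a)) (m' + n')"
    by (rule skein_module_pad[OF cups_in]; use assms in simp)
      (rule skein_module_pad[OF caps_in]; use assms in simp)
  then show ?thesis
    unfolding arcs_element_def clustered_module_def
    by (intro imageI) (auto simp: pad_def intro: skein_module_above)
qed

theorem theorem3p1:
  fixes m n m' n' k l :: nat
  assumes "l \<le> k" and "1 \<le> l"
    and "m + k = m' + l" and "n + k = n' + l"
  shows "bubble m n m' n' k l \<in> clustered_module m n m' n' \<and>
    (\<forall>i \<le> min (min m n) l. arcs_element m n m' n' i (k - l + i) \<in> clustered_module m n m' n') \<and>
    bubble m n m' n' k l =
      (\<Sum>i = 0..min (min m n) l.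
        bubble_coeff m n k l i *\<^sub>K arcs_element m n m' n' i (k - l + i))"
proof (intro conjI allI impI)
  show "bubble m n m' n' k l \<in> clustered_module m n m' n'"
    using assms by (intro bubble_in_clustered_module)
  show "arcs_element m n m' n' i (k - l + i) \<in> clustered_module m n m' n'"
    if "i \<le> min (min m n) l" for i
    using assms that by (intro arcs_element_in_clustered_module) auto
  show "bubble m n m' n' k l = (\<Sum>i = 0..min (min m n) l.
      bubble_coeff m n k l i *\<^sub>K arcs_element m n m' n' i (k - l + i))"
    unfolding bubble_expansion[OF assms(1,3,4)]
    by (rule sum.mono_neutral_right) (auto simp: bubble_coeff_eq_0)
qed

end
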